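(* For all $j,f\ge0$, as formal power series in $t$, $$\frac{F_{j,f}(t)}{(1-t)^{2j+f+1}}=\sum_{m\ge0}c_f(m)\binom{m^2+m+j-1}{j}t^m,$$ where $c_f(m)=[u^f]\,\dfrac{(1+u)^m}{(1-u)^{m+1}}$.
   Context: $[u^f]$ denotes extraction of the coefficient of $u^f$. The binomial coefficient $\binom{m^2+m+j-1}{j}$ is the coefficient of $z^{j}$ in $(1-z)^{-m(m+1)}$; in particular it equals $1$ when $j=0$ (also for $m=0$), and $0$ when $m=0$, $j\ge1$. For $n\ge1$, $\mathfrak B_n$ is the hyperoctahedral group of signed permutations: words $\pi=\pi_1\cdots\pi_n$ of nonzero integers such that $|\pi_1|,\dots,|\pi_n|$ is a permutation of $[n]=\{1,\dots,n\}$, with $\pi(i)=\pi_i$, $\pi(-i)=-\pi(i)$. $\mathcal I_n^B$ is the set of $\pi\in\mathfrak B_n$ with $\pi^2=\mathrm{id}$ (for $n=0$, a single empty involution). With $\pi_0=0$ and the usual order on $\mathbb Z$, $\operatorname{des}^B(\pi)=\#\{0\le i\le n-1:\pi_i>\pi_{i+1}\}$. $\operatorname{fix}_B(\pi)=\#\{i\in[n]:|\pi(i)|=i\}$, and $\operatorname{cyc}_2(\pi)$ is the number of two-cycles of the ordinary involution $i\mapsto|\pi(i)|$ of $[n]$. For $j,f\ge0$, $$F_{j,f}(t)=\sum_{\substack{\pi\in\mathcal I_{2j+f}^B\\ \operatorname{cyc}_2(\pi)=j,\ \operatorname{fix}_B(\pi)=f}}t^{\operatorname{des}^B(\pi)}.$$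 *)

theory Defs
  imports Complex_Main "HOL-Computational_Algebra.Computational_Algebra"
begin

(* A signed permutation of [n] is given by its odd extension p to the integers, so that the word
   is p 1 ... p n and p 0 = 0. The requirement p i = i for |i| > n only fixes the irrelevant
   values, so that each signed permutation is represented by exactly one function. *)
definition signed_perms :: "nat \<Rightarrow> (int \<Rightarrow> int) set" where
  "signed_perms n = {p. bij_betw (\<lambda>i. \<bar>p i\<bar>) {1..int n} {1..int n} \<and>
     (\<forall>i. p (- i) = - p i) \<and> (\<forall>i. \<bar>i\<bar> > int n \<longrightarrow> p i = i)}"

definition signed_involutions :: "nat \<Rightarrow> (int \<Rightarrow> int) set" where
  "signed_involutions n = {p \<in> signed_perms n. p \<circ> p = id}"

definition desB :: "nat \<Rightarrow> (int \<Rightarrow> int) \<Rightarrow> nat" where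
  "desB n p = card {i. 0 \<le> i \<and> i \<le> int n - 1 \<and> p i > p (i + 1)}"

definition fixB :: "nat \<Rightarrow> (int \<Rightarrow> int) \<Rightarrow> nat" where
  "fixB n p = card {i \<in> {1..int n}. \<bar>p i\<bar> = i}"

(* A two-cycle (i k) is counted once, through the pair with i < k. *)
definition cyc2 :: "nat \<Rightarrow> (int \<Rightarrow> int) \<Rightarrow> nat" where
  "cyc2 n p = card {(i, k). i \<in> {1..int n} \<and> k \<in> {1..int n} \<and> i < k \<and>
     \<bar>p i\<bar> = k \<and> \<bar>p k\<bar> = i}"

definition F :: "nat \<Rightarrow> nat \<Rightarrow> rat poly" where
  "F j f = (\<Sum>p \<in> {p \<in> signed_involutions (2 * j + f).
                      cyc2 (2 * j + f) p = j \<and> fixB (2 * j + f) p = f}.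
              monom 1 (desB (2 * j + f) p))"

definition c :: "nat \<Rightarrow> nat \<Rightarrow> rat" where
  "c f m = fps_nth ((1 + fps_X) ^ m / (1 - fps_X) ^ (m + 1)) f"

(* The sum in F is over a finite set, so it is not trivially 0. *)
lemma finite_signed_perms: "finite (signed_perms n)"
proof (rule finite_subset)
  let ?A = "{- int n..int n}"
  let ?S = "{q. \<forall>i. (i \<in> ?A \<longrightarrow> q i \<in> ?A) \<and> (i \<notin> ?A \<longrightarrow> q i = 0)}"
  define ext :: "(int \<Rightarrow> int) \<Rightarrow> int \<Rightarrow> int" where "ext q i = (if i \<in> ?A then q i else i)" for q i
  show "signed_perms n \<subseteq> ext ` ?S"
  proof
    fix p assume p: "p \<in> signed_perms n"
    then have odd: "p (- i) = - p i" for i by (simp add: signed_perms_def)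
    have out: "p i = i" if "\<bar>i\<bar> > int n" for i using p that by (simp add: signed_perms_def)
    have pos: "\<bar>p i\<bar> \<in> {1..int n}" if "i \<in> {1..int n}" for i
      using p that bij_betwE by (fastforce simp: signed_perms_def)
    have "p i \<in> ?A" if "i \<in> ?A" for i
    proof -
      have "p 0 = 0" using odd[of 0] by simp
      moreover have "i = 0 \<or> i \<in> {1..int n} \<or> - i \<in> {1..int n}" using that by auto
      ultimately show ?thesis using pos[of i] pos[of "- i"] odd[of i] by auto
    qed
    then have "(\<lambda>i. if i \<in> ?A then p i else 0) \<in> ?S" by auto
    then have "ext (\<lambda>i. if i \<in> ?A then p i else 0) \<in> ext ` ?S" by (rule imageI)
    moreover have "ext (\<lambda>i. if i \<in> ?A then p i else 0) = p"
      using out by (auto simp: fun_eq_iff ext_def)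
    ultimately show "p \<in> ext ` ?S" by (simp only:)
  qed
  show "finite (ext ` ?S)"
    by (intro finite_imageI finite_set_of_finite_funs) auto
qed

(* The generalized binomial coefficient used in the statement is the coefficient of z^j in
   (1 - z)^(-m(m+1)), also in the degenerate cases with m = 0. *)
lemma gchoose_eq_coeff:
  "(of_nat (m ^ 2 + m + j) - 1 :: rat) gchoose j = fps_nth (1 / (1 - fps_X) ^ (m * (m + 1))) j"
proof (cases "m = 0")
  case True
  have "(of_nat j - 1 :: rat) gchoose j = (if j = 0 then 1 else 0)"
  proof (cases j)
    case (Suc k)
    then have "(of_nat j - 1 :: rat) gchoose j = of_nat (k choose Suc k)"
      by (simp add: binomial_gbinomial)
    with Suc show ?thesis by simp
  qed simp
  with True show ?thesis by simp
next
  case False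
  let ?N = "m * (m + 1)"
  have "?N > 0" using False by simp
  have N: "of_nat (m ^ 2 + m + j) - 1 = (of_nat (?N + j - 1) :: rat)"
    using \<open>?N > 0\<close> by (subst of_nat_diff) (simp_all add: power2_eq_square algebra_simps)
  have "1 / (1 - fps_X :: rat fps) ^ ?N = inverse ((1 - fps_const 1 * fps_X) ^ ?N)"
    by (simp add: fps_divide_unit)
  also have "fps_nth \<dots> j = of_nat ((?N + j - 1) choose j)"
    using \<open>?N > 0\<close> by (subst one_minus_const_fps_X_neg_power') simp_all
  finally show ?thesis unfolding N binomial_gbinomial by (rule sym)
qed

end

(* By the theory of P-partitions, t^des(p) / (1 - t)^(n+1) is the generating function in m of the odd
   weakly increasing labellings s of {-n..n} by {-m..m} that increase strictly at the descents of p.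
   Summing over the involutions p, the coefficient of t^m counts pairs (p, s). Such a pair is encoded
   by the multiset of the pairs (s i, s (p i)), |i| <= n. This multiset is invariant under negation and
   swapping, and it determines (p, s): sorting it lexicographically recovers s and the word s o p, and
   p is the standardization of that word.

   An invariant multiset is freely described by the multiplicities of its orbits. A pair (a, a) yields
   a point p i = i. Positions carrying (a, -a) are reversed up to sign, so they yield two-cycles and, if
   their number is odd, one point p i = -i. All other orbits yield two-cycles. There are m (m + 1) kinds
   of two-cycles, m + 1 kinds of points p i = i (0 <= a <= m), and m kinds of points p i = -i
   (1 <= a <= m), the latter occurring at most once each. *)

theory Submission
  imports Defs "HOL-Library.Product_Lexorder"
begin

subsection \<open>Compatible labellings\<close>

text \<open>These are the P-partitions of the word \<open>p 0\<close>, ..., \<open>p n\<close>,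
  extended oddly. Values beyond \<open>n\<close> are pinned to 0 so that each labelling is a single
  function. The bound is an integer so that the recursion on \<open>n\<close> may lower it to
  -1.\<close>

definition labellings :: "nat \<Rightarrow> int \<Rightarrow> (int \<Rightarrow> int) \<Rightarrow> (int \<Rightarrow> int) set" where
  "labellings n m p = {s. (\<forall>i. s (- i) = - s i) \<and> (\<forall>i. \<bar>i\<bar> > int n \<longrightarrow> s i = 0) \<and>
     (\<forall>i\<in>{0..<int n}. s i \<le> s (i + 1) \<and> (p i > p (i + 1) \<longrightarrow> s i < s (i + 1))) \<and> s (int n) \<le> m}"

lemma labellings_0: "labellings 0 m p = (if m \<ge> 0 then {\<lambda>_. 0} else {})"
proof (intro equalityI subsetI)
  fix s assume s: "s \<in> labellings 0 m p"
  have "s (- 0) = - s 0" using s unfolding labellings_def by blast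
  then have "s 0 = 0" by simp
  moreover have "s i = 0" if "i \<noteq> 0" for i using s that by (simp add: labellings_def)
  ultimately have "s i = 0" for i by metis
  then have "s = (\<lambda>_. 0)" by blast
  with s show "s \<in> (if m \<ge> 0 then {\<lambda>_. 0} else {})" by (simp add: labellings_def)
next
  fix s :: "int \<Rightarrow> int" assume "s \<in> (if m \<ge> 0 then {\<lambda>_. 0 :: int} else {})"
  then show "s \<in> labellings 0 m p" by (simp add: labellings_def split: if_splits)
qed

lemma labelling_nonneg:
  assumes "s \<in> labellings n m p" shows "s (int n) \<ge> 0"
proof -
  have "s (- 0) = - s 0" using assms unfolding labellings_def by blast
  then have s0: "s 0 = 0" by simp
  have "k \<le> n \<Longrightarrow> s (int k) \<ge> 0" for k
  proof (induction k)
    case (Suc k)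
    then have "s (int k) \<le> s (int k + 1)" using assms by (auto simp: labellings_def)
    with Suc show ?case by (simp add: add.commute)
  qed (simp add: s0)
  then show ?thesis by blast
qed

lemma labellings_neg: "m < 0 \<Longrightarrow> labellings n m p = {}"
proof (rule equals0I)
  fix s assume "m < 0" "s \<in> labellings n m p"
  then have "s (int n) \<le> m" by (simp add: labellings_def)
  with labelling_nonneg[OF \<open>s \<in> _\<close>] \<open>m < 0\<close> show False by simp
qed

text \<open>Split by the top label \<open>v\<close>. A descent at \<open>n\<close> demands a
  strictly smaller label there, which over the integers is the bound \<open>v - 1\<close>.\<close>

lemma labellings_Suc:
  fixes n p
  defines "d \<equiv> (if p (int n) > p (int n + 1) then 1 else 0)"
  shows "labellings (Suc n) m p =
    (\<Union>v\<in>{0..m}. (\<lambda>s. s(int n + 1 := v, - int n - 1 := - v)) ` labellings n (v - d) p)" (is "?L = ?R")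
proof (intro equalityI subsetI)
  fix s assume s: "s \<in> ?L"
  have odd: "s (- i) = - s i" for i using s by (simp add: labellings_def)
  have step: "s i \<le> s (i + 1) \<and> (p i > p (i + 1) \<longrightarrow> s i < s (i + 1))" if "0 \<le> i" "i \<le> int n" for i
    using s that by (simp add: labellings_def)
  have out: "s i = 0" if "\<bar>i\<bar> > int n + 1" for i using s that by (simp add: labellings_def)
  define v where "v = s (int n + 1)"
  define s' where "s' = s(int n + 1 := 0, - int n - 1 := 0)"
  have s'_eq: "s' i = (if \<bar>i\<bar> \<le> int n then s i else 0)" for i
    using out[of i] by (auto simp: s'_def)
  have v: "v \<in> {0..m}" using labelling_nonneg[OF s] s by (simp add: labellings_def v_def add.commute)
  have "s' \<in> labellings n (v - d) p"
    using step odd by (auto simp: labellings_def s'_eq v_def d_def)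
  moreover have "s = s'(int n + 1 := v, - int n - 1 := - v)"
    using odd[of "int n + 1"] by (auto simp: s'_def v_def fun_eq_iff)
  ultimately show "s \<in> ?R" using v by blast
next
  fix s assume "s \<in> ?R"
  then obtain v s' where v: "v \<in> {0..m}" and s': "s' \<in> labellings n (v - d) p"
    and s: "s = s'(int n + 1 := v, - int n - 1 := - v)" by blast
  have s'_odd: "s' (- i) = - s' i" and s'_out: "\<bar>i\<bar> > int n \<Longrightarrow> s' i = 0" for i
    using s' unfolding labellings_def by blast+
  have "s (- i) = - s i" for i by (auto simp: s s'_odd)
  moreover have "s i \<le> s (i + 1) \<and> (p i > p (i + 1) \<longrightarrow> s i < s (i + 1))" if "0 \<le> i" "i \<le> int n" for i
    using s' that by (cases "i = int n") (auto simp: s labellings_def d_def split: if_splits)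
  moreover have "s i = 0" if "\<bar>i\<bar> > int n + 1" for i
    using that by (auto simp: s s'_out)
  moreover have "s (int n + 1) \<le> m" using v by (simp add: s)
  ultimately show "s \<in> ?L" by (simp add: labellings_def add.commute)
qed

lemma finite_labellings: "finite (labellings n m p)"
proof (induction n arbitrary: m)
  case 0
  then show ?case by (simp add: labellings_0)
next
  case (Suc n)
  then show ?case unfolding labellings_Suc by (intro finite_UN_I finite_imageI) simp_all
qed

lemma card_labellings_Suc:
  "card (labellings (Suc n) m p) =
    (\<Sum>v\<in>{0..m}. card (labellings n (v - (if p (int n) > p (int n + 1) then 1 else 0)) p))"
proof -
  have out: "s (int n + 1) = 0" "s (- int n - 1) = 0" if "s \<in> labellings n v p" for s v
    using that by (simp_all add: labellings_def)
  \<comment> \<open>The update loses no information, since members of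
    \<open>labellings n w p\<close> vanish at both overwritten positions.\<close>
  have inj: "inj_on (\<lambda>s. s(int n + 1 := v, - int n - 1 := - v)) (labellings n w p)" for v w
  proof (rule inj_onI)
    fix s s' :: "int \<Rightarrow> int" assume s: "s \<in> labellings n w p" "s' \<in> labellings n w p"
      and eq: "s(int n + 1 := v, - int n - 1 := - v) = s'(int n + 1 := v, - int n - 1 := - v)"
    show "s = s'"
    proof
      fix i show "s i = s' i" using fun_cong[OF eq, of i] out[OF s(1)] out[OF s(2)]
        by (auto split: if_splits)
    qed
  qed
  let ?U = "\<lambda>v s. s(int n + 1 := v, - int n - 1 := - v)"
  let ?T = "\<lambda>v. ?U v ` labellings n (v - (if p (int n) > p (int n + 1) then 1 else 0)) p"
  have val: "s (int n + 1) = v" if "s \<in> ?T v" for s v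
    using that by (elim imageE) simp
  have "card (labellings (Suc n) m p) = (\<Sum>v\<in>{0..m}. card (?T v))"
    unfolding labellings_Suc
  proof (rule card_UN_disjoint)
    show "\<forall>v\<in>{0..m}. finite (?T v)" by (intro ballI finite_imageI finite_labellings)
    show "\<forall>v\<in>{0..m}. \<forall>w\<in>{0..m}. v \<noteq> w \<longrightarrow> ?T v \<inter> ?T w = {}"
      using val by (metis disjoint_iff)
  qed simp
  also have "\<dots> = (\<Sum>v\<in>{0..m}. card (labellings n (v - (if p (int n) > p (int n + 1) then 1 else 0)) p))"
    by (intro sum.cong refl card_image inj)
  finally show ?thesis .
qed

lemma finite_descents: "finite {i. 0 \<le> i \<and> i \<le> (n::int) - 1 \<and> P i}"
  by (rule finite_subset[of _ "{0..n-1}"]) auto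

lemma desB_Suc: "desB (Suc n) p = desB n p + (if p (int n) > p (int n + 1) then 1 else 0)"
proof -
  have "{i. 0 \<le> i \<and> i \<le> int (Suc n) - 1 \<and> p i > p (i + 1)} =
    {i. 0 \<le> i \<and> i \<le> int n - 1 \<and> p i > p (i + 1)} \<union> (if p (int n) > p (int n + 1) then {int n} else {})"
    by (auto simp: le_less)
  then show ?thesis unfolding desB_def
    using finite_descents[of "int n" "\<lambda>i. p i > p (i + 1)"] by simp
qed

text \<open>Each further position sums over the top label, which is division by
  \<open>1 - fps_X\<close>; a descent lowers the bound by one, which is a factor
  \<open>fps_X\<close>.\<close>

lemma fps_card_labellings:
  "Abs_fps (\<lambda>m. of_nat (card (labellings n (int m) p))) =
    (fps_X ^ desB n p / (1 - fps_X) ^ (n + 1) :: rat fps)"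
proof (induction n)
  case 0
  have "(1 / (1 - fps_X) :: rat fps) = Abs_fps (\<lambda>_. 1)"
    by (subst fps_divide_fps_X_minus1_sum) (simp add: fps_eq_iff)
  moreover have "desB 0 p = 0" unfolding desB_def by (subst card_eq_0_iff) auto
  ultimately show ?case by (simp add: labellings_0)
next
  case (Suc n)
  let ?d = "if p (int n) > p (int n + 1) then 1 else 0 :: nat"
  let ?C = "\<lambda>n. Abs_fps (\<lambda>m. of_nat (card (labellings n (int m) p))) :: rat fps"
  have "?C (Suc n) = fps_X ^ ?d * ?C n / (1 - fps_X)"
  proof (subst fps_divide_fps_X_minus1_sum, rule fps_ext)
    fix m
    have "card (labellings (Suc n) (int m) p) = 
      (\<Sum>v\<in>{0..m}. card (labellings n (int v - (if p (int n) > p (int n + 1) then 1 else 0)) p))"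
      unfolding card_labellings_Suc
      by (rule sum.reindex_bij_witness[of _ int nat]) auto
    \<comment> \<open>At a descent with \<open>v = 0\<close> the bound is -1 and the count is 0, in
      agreement with the constant coefficient of \<open>fps_X * ?C n\<close>.\<close>
    also have "of_nat \<dots> = (\<Sum>v\<in>{0..m}. fps_nth (fps_X ^ ?d * ?C n) v)"
      unfolding of_nat_sum
      by (rule sum.cong) (auto simp: labellings_neg of_nat_diff)
    finally show "fps_nth (?C (Suc n)) m = fps_nth (Abs_fps (\<lambda>m. \<Sum>v\<in>{0..m}. fps_nth (fps_X ^ ?d * ?C n) v)) m"
      by simp
  qed
  also have "\<dots> = fps_X ^ desB (Suc n) p / (1 - fps_X) ^ (Suc n + 1)"
    unfolding Suc desB_Suc
    by (simp add: fps_divide_unit fps_inverse_power power_add mult_ac fps_inverse_mult)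
  finally show ?case .
qed

section \<open>Monotone maps on finite linear orders and their multisets of values\<close>

lemma card_filter_eq_size_image_mset:
  assumes "finite A"
  shows "card {i\<in>A. P (u i)} = size (filter_mset P (image_mset u (mset_set A)))"
proof -
  have "{i\<in>A. P (u i)} = {i\<in>A. (P \<circ> u) i}" by simp
  then show ?thesis
    using assms by (simp add: filter_mset_image_mset o_def)
qed

text \<open>Both maps list the same multiset in sorted order. If \<open>u i < v i\<close>, then
  \<open>v\<close> takes values up to \<open>u i\<close> only at positions before \<open>i\<close>,
  whereas \<open>u\<close> does so at all positions up to \<open>i\<close>; but the number of such
  positions depends on the multiset alone.\<close>

lemma monotone_image_mset_unique:
  fixes u v :: "'a :: linorder \<Rightarrow> 'b :: linorder"
  assumes fin: "finite A" and u: "mono_on A u" and v: "mono_on A v"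
    and eq: "image_mset u (mset_set A) = image_mset v (mset_set A)" and i: "i \<in> A"
  shows "u i = v i"
proof -
  have "\<not> u i < v i" if "mono_on A u" "mono_on A v"
    "image_mset u (mset_set A) = image_mset v (mset_set A)" for u v :: "'a \<Rightarrow> 'b"
  proof
    assume less: "u i < v i"
    have "card {k\<in>A. v k \<le> u i} = card {k\<in>A. u k \<le> u i}"
      using card_filter_eq_size_image_mset[OF fin, of "\<lambda>x. x \<le> u i"] that(3) by metis
    moreover have "{k\<in>A. v k \<le> u i} \<subseteq> {k\<in>A. k < i}"
    proof (intro subsetI CollectI conjI)
      fix k assume k: "k \<in> {k\<in>A. v k \<le> u i}"
      then show "k \<in> A" by simp
      show "k < i"
      proof (rule ccontr)
        assume "\<not> k < i"
        then have "v i \<le> v k" using monotone_onD[OF that(2) i, of k] k by simp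
        with k less show False by (auto dest: order_trans)
      qed
    qed
    then have "card {k\<in>A. v k \<le> u i} \<le> card {k\<in>A. k < i}" using fin by (intro card_mono) auto
    moreover have "{k\<in>A. k \<le> i} \<subseteq> {k\<in>A. u k \<le> u i}"
      using monotone_onD[OF that(1) _ i] by auto
    then have "card {k\<in>A. k \<le> i} \<le> card {k\<in>A. u k \<le> u i}" using fin by (intro card_mono) auto
    moreover have "{k\<in>A. k \<le> i} = insert i {k\<in>A. k < i}" using i by auto
    then have "card {k\<in>A. k \<le> i} = Suc (card {k\<in>A. k < i})" using fin by simp
    ultimately show False by simp
  qed
  from this[OF u v eq] this[OF v u eq[symmetric]] show ?thesis by simp
qed

lemma image_mset_mset_set_bij:
  "bij_betw q A B \<Longrightarrow> image_mset (\<lambda>i. u (q i)) (mset_set A) = image_mset u (mset_set B)"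
  using image_mset_mset_set[of q A] by (auto simp: bij_betw_def multiset.map_comp o_def dest!: arg_cong[of _ _ "image_mset u"])

text \<open>\<open>Y\<close> is sorted along \<open>p\<close>, so composing it with the inverse of
  \<open>p\<close> gives a monotone map with the same multiset of values as
  \<open>X\<close>.\<close>

lemma monotone_along_bij_unique:
  fixes X :: "'a :: linorder \<Rightarrow> 'b :: linorder"
  assumes fin: "finite A" and p: "bij_betw p A A" and X: "mono_on A X"
    and Y: "\<And>i k. i \<in> A \<Longrightarrow> k \<in> A \<Longrightarrow> p i \<le> p k \<Longrightarrow> Y i \<le> Y k"
    and eq: "image_mset X (mset_set A) = image_mset Y (mset_set A)" and i: "i \<in> A"
  shows "Y i = X (p i)"
proof -
  define q where "q = the_inv_into A p"
  have q: "bij_betw q A A" unfolding q_def by (rule bij_betw_the_inv_into[OF p])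
  have pq: "p (q k) = k" "q k \<in> A" if "k \<in> A" for k
    using that p q by (auto simp: q_def bij_betw_def f_the_inv_into_f)
  have "X (p i) = Y (q (p i))"
  proof (rule monotone_image_mset_unique[OF fin X])
    show "mono_on A (\<lambda>i. Y (q i))" using Y pq by (auto intro!: monotone_onI)
    show "image_mset X (mset_set A) = image_mset (\<lambda>i. Y (q i)) (mset_set A)"
      using image_mset_mset_set_bij[OF q, of Y] eq by simp
    show "p i \<in> A" using p i by (auto simp: bij_betw_def)
  qed
  also have "q (p i) = i" unfolding q_def using p i by (simp add: bij_betw_def the_inv_into_f_f)
  finally show ?thesis by simp
qed

text \<open>Both \<open>u\<close> and the identity list \<open>A\<close> in increasing
  order.\<close>

lemma strict_mono_on_bij_id:
  fixes u :: "'a :: linorder \<Rightarrow> 'a"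
  assumes fin: "finite A" and "bij_betw u A A" "\<And>i k. i \<in> A \<Longrightarrow> k \<in> A \<Longrightarrow> i < k \<Longrightarrow> u i < u k" "i \<in> A"
  shows "u i = i"
proof (rule monotone_image_mset_unique[OF fin _ _ _ \<open>i \<in> A\<close>])
  show "mono_on A u" using assms(3) by (intro monotone_onI) (metis le_less)
  show "mono_on A (\<lambda>i. i)" by (intro monotone_onI)
  show "image_mset u (mset_set A) = image_mset (\<lambda>i. i) (mset_set A)"
    using image_mset_mset_set_bij[OF assms(2), of "\<lambda>i. i"] by simp
qed

lemma less_of_step_less:
  fixes u :: "int \<Rightarrow> 'a :: order"
  assumes step: "\<And>i. a \<le> i \<Longrightarrow> i < b \<Longrightarrow> u i < u (i + 1)" and "a \<le> i" "i < k" "k \<le> b"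
  shows "u i < u k"
  using assms(3,4)
proof (induction k rule: int_gr_induct)
  case base
  then show ?case using step \<open>a \<le> i\<close> by simp
next
  case (step k)
  then show ?case using assms(1)[of k] \<open>a \<le> i\<close> by force
qed

section \<open>Signed involutions and the order of positions induced by a labelling\<close>

lemma signed_involutionD:
  assumes "p \<in> signed_involutions n"
  shows signed_involution_odd: "p (- i) = - p i"
    and signed_involution_out: "\<bar>i\<bar> > int n \<Longrightarrow> p i = i"
    and signed_involution_involutive: "p (p i) = i"
    and signed_involution_range: "i \<in> {- int n..int n} \<Longrightarrow> p i \<in> {- int n..int n}"
proof -
  show odd: "p (- i) = - p i" for i using assms by (simp add: signed_involutions_def signed_perms_def)
  show out: "\<bar>i\<bar> > int n \<Longrightarrow> p i = i" for i
    using assms by (simp add: signed_involutions_def signed_perms_def)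
  show inv: "p (p i) = i" for i
    using assms by (auto simp: signed_involutions_def fun_eq_iff)
  show "p i \<in> {- int n..int n}" if "i \<in> {- int n..int n}"
  proof (rule ccontr)
    assume "\<not> ?thesis"
    then have "\<bar>p i\<bar> > int n" by auto
    then have "p (p i) = p i" by (rule out)
    with inv \<open>\<not> ?thesis\<close> that show False by simp
  qed
qed

lemma signed_involutionI:
  assumes odd: "\<And>i. p (- i) = - p i" and out: "\<And>i. \<bar>i\<bar> > int n \<Longrightarrow> p i = i"
    and inv: "\<And>i. p (p i) = i"
  shows "p \<in> signed_involutions n"
proof -
  have zero: "p 0 = 0" using odd[of 0] by simp
  have "inj_on (\<lambda>i. \<bar>p i\<bar>) {1..int n}"
  proof (rule inj_onI)
    fix i k assume ik: "i \<in> {1..int n}" "k \<in> {1..int n}" "\<bar>p i\<bar> = \<bar>p k\<bar>"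
    then have "p i = p k \<or> p i = p (- k)" using odd by fastforce
    then have "i = k \<or> i = - k" using inv by metis
    with ik show "i = k" by auto
  qed
  moreover have "\<bar>p i\<bar> \<in> {1..int n}" if "i \<in> {1..int n}" for i
  proof -
    have "p i \<noteq> 0" using inv[of i] zero that by auto
    moreover have "\<bar>p i\<bar> \<le> int n" using out[of "p i"] inv[of i] that by fastforce
    ultimately show ?thesis by simp
  qed
  ultimately have "bij_betw (\<lambda>i. \<bar>p i\<bar>) {1..int n} {1..int n}"
    by (intro bij_betw_imageI endo_inj_surj) auto
  then show ?thesis using assms by (simp add: signed_involutions_def signed_perms_def fun_eq_iff)
qed

lemma signed_involution_bij:
  assumes "p \<in> signed_involutions n" shows "bij_betw p {- int n..int n} {- int n..int n}"
  by (rule bij_betw_byWitness[of _ p])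
    (use signed_involution_involutive[OF assms] signed_involution_range[OF assms] in auto)

text \<open>A stretch of equal labels contains no descent, so \<open>p\<close> increases along it.
  The later comparisons of positions rest on this strict order.\<close>

lemma labelling_lex_less:
  assumes p: "p \<in> signed_involutions n" and s: "s \<in> labellings n m p"
    and "- int n \<le> i" "i < k" "k \<le> int n"
  shows "(s i, p i) < (s k, p k)"
proof (rule less_of_step_less[where u = "\<lambda>i. (s i, p i)" and a = "- int n" and b = "int n"])
  have pos: "(s i, p i) < (s (i + 1), p (i + 1))" if "0 \<le> i" "i < int n" for i
  proof -
    have "p i \<noteq> p (i + 1)" using signed_involution_involutive[OF p] by (metis add_cancel_right_right zero_neq_one)
    moreover have "s i \<le> s (i + 1) \<and> (p i > p (i + 1) \<longrightarrow> s i < s (i + 1))"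
      using s that unfolding labellings_def by auto
    ultimately show ?thesis by auto
  qed
  have odd: "s (- i) = - s i" for i using s by (simp add: labellings_def)
  show "(s i, p i) < (s (i + 1), p (i + 1))" if "- int n \<le> i" "i < int n" for i
  proof (cases "i \<ge> 0")
    case False
    \<comment> \<open>Oddness reflects a step at negative \<open>i\<close> to the step from
      \<open>- (i + 1)\<close> to \<open>- i\<close>.\<close>
    then have "(s (- (i + 1)), p (- (i + 1))) < (s (- i), p (- i))" using pos[of "- (i + 1)"] that by simp
    then show ?thesis unfolding odd signed_involution_odd[OF p] by auto
  qed (use pos that in blast)
qed fact+

lemma labelling_range:
  assumes p: "p \<in> signed_involutions n" and s: "s \<in> labellings n m p"
  shows "s i \<in> {- m..m}"
proof -
  have odd: "s (- i) = - s i" and out: "\<bar>i\<bar> > int n \<Longrightarrow> s i = 0" for i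
    using s by (simp_all add: labellings_def)
  have top: "s (int n) \<le> m" using s by (simp add: labellings_def)
  have le: "s i \<le> m" for i
  proof (cases "\<bar>i\<bar> < int n")
    case True
    then show ?thesis using labelling_lex_less[OF p s, of i "int n"] top by (auto simp: abs_less_iff)
  next
    case False
    then consider "i = int n" | "i = - int n" | "\<bar>i\<bar> > int n" by linarith
    then show ?thesis using top labelling_nonneg[OF s] by cases (auto simp: odd out)
  qed
  from le[of i] le[of "- i"] show ?thesis by (simp add: odd)
qed

subsection \<open>Involutions and symmetric multisets of pairs\<close>

abbreviation neg_pair :: "int \<times> int \<Rightarrow> int \<times> int" where
  "neg_pair \<equiv> map_prod uminus uminus"

definition biword :: "nat \<Rightarrow> (int \<Rightarrow> int) \<Rightarrow> (int \<Rightarrow> int) \<Rightarrow> (int \<times> int) multiset" where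
  "biword n p s = image_mset (\<lambda>i. (s i, s (p i))) (mset_set {- int n..int n})"

definition sym_multisets :: "nat \<Rightarrow> int \<Rightarrow> (int \<times> int) multiset set" where
  "sym_multisets n m = {M. image_mset neg_pair M = M \<and> image_mset prod.swap M = M \<and>
     size M = 2 * n + 1 \<and> set_mset M \<subseteq> {- m..m} \<times> {- m..m}}"

lemma bij_betw_uminus: "bij_betw uminus {- int n..int n} {- int n..int n}"
  by (rule bij_betw_byWitness[of _ uminus]) auto

text \<open>Negating the positions negates the pairs, and permuting the positions by
  \<open>p\<close> swaps the components. Neither reindexing changes the multiset.\<close>

lemma biword_in_sym_multisets:
  assumes p: "p \<in> signed_involutions n" and s: "s \<in> labellings n m p"
  shows "biword n p s \<in> sym_multisets n m"
proof -
  have odd: "s (- i) = - s i" for i using s by (simp add: labellings_def)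
  have "image_mset neg_pair (biword n p s) = image_mset (\<lambda>i. (s (- i), s (p (- i)))) (mset_set {- int n..int n})"
    by (simp add: biword_def multiset.map_comp o_def odd signed_involution_odd[OF p])
  also have "\<dots> = biword n p s"
    unfolding biword_def by (rule image_mset_mset_set_bij[OF bij_betw_uminus])
  finally have "image_mset neg_pair (biword n p s) = biword n p s" .
  moreover have "image_mset prod.swap (biword n p s) = 
      image_mset (\<lambda>i. (s (p i), s (p (p i)))) (mset_set {- int n..int n})"
    by (simp add: biword_def multiset.map_comp o_def signed_involution_involutive[OF p])
  then have "image_mset prod.swap (biword n p s) = biword n p s"
    unfolding biword_def
    using image_mset_mset_set_bij[OF signed_involution_bij[OF p], of "\<lambda>i. (s i, s (p i))"] by simp
  moreover have "size (biword n p s) = 2 * n + 1" by (simp add: biword_def)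
  moreover have "set_mset (biword n p s) \<subseteq> {- m..m} \<times> {- m..m}"
    using labelling_range[OF p s] by (auto simp: biword_def)
  ultimately show ?thesis by (simp add: sym_multisets_def)
qed

text \<open>Where two labels agree, \<open>p\<close> increases, hence \<open>s (p i)\<close>
  increases weakly. Reading the positions from left to right therefore lists the multiset in sorted
  order.\<close>

lemma mono_on_biword:
  assumes p: "p \<in> signed_involutions n" and s: "s \<in> labellings n m p"
  shows "mono_on {- int n..int n} (\<lambda>i. (s i, s (p i)))"
proof (rule monotone_onI)
  fix i k assume ik: "i \<in> {- int n..int n}" "k \<in> {- int n..int n}" "i \<le> k"
  show "(s i, s (p i)) \<le> (s k, s (p k))"
  proof (cases "i = k")
    case False
    then have *: "(s i, p i) < (s k, p k)" using labelling_lex_less[OF p s] ik by simp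
    have "s (p i) \<le> s (p k)" if "p i < p k"
    proof -
      have "- int n \<le> p i" "p k \<le> int n" using signed_involution_range[OF p] ik by auto
      from labelling_lex_less[OF p s this(1) that this(2)] show ?thesis by auto
    qed
    with * show ?thesis by auto
  qed simp
qed

text \<open>This is the lexicographic order at the positions \<open>p i\<close> and
  \<open>p k\<close>, which \<open>p\<close> maps back to \<open>i\<close> and \<open>k\<close>. It
  exhibits \<open>p\<close> as the standardization of the word \<open>s (p i)\<close>, with ties
  broken by position.\<close>

lemma labelling_less_iff:
  assumes p: "p \<in> signed_involutions n" and s: "s \<in> labellings n m p"
    and ik: "i \<in> {- int n..int n}" "k \<in> {- int n..int n}"
  shows "p i < p k \<longleftrightarrow> (s (p i), i) < (s (p k), k)"
proof -
  have *: "(s (p i), i) < (s (p k), k)" 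
    if "p i < p k" "i \<in> {- int n..int n}" "k \<in> {- int n..int n}" for i k
  proof -
    have "- int n \<le> p i" "p k \<le> int n" using signed_involution_range[OF p] that by auto
    from labelling_lex_less[OF p s this(1) that(1) this(2)] show ?thesis
      by (simp add: signed_involution_involutive[OF p])
  qed
  have "p i = p k \<Longrightarrow> i = k" using signed_involution_involutive[OF p] by metis
  then show ?thesis using *[of i k] *[of k i] ik by (metis less_asym linorder_less_linear order_less_irrefl)
qed

text \<open>Sorting recovers the words \<open>s i\<close> and \<open>s (p i)\<close>, and these fix
  the relative order of the values of \<open>p\<close>. Hence \<open>p' (p i)\<close> is increasing
  in \<open>i\<close> on \<open>{- int n..int n}\<close> and is the identity there.\<close>

lemma biword_inj:
  assumes p: "p \<in> signed_involutions n" and s: "s \<in> labellings n m p"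
    and p': "p' \<in> signed_involutions n" and s': "s' \<in> labellings n m' p'"
    and eq: "biword n p s = biword n p' s'"
  shows "p = p' \<and> s = s'"
proof -
  let ?I = "{- int n..int n}"
  have word: "s i = s' i \<and> s (p i) = s' (p' i)" if "i \<in> ?I" for i
    using monotone_image_mset_unique[OF _ mono_on_biword[OF p s] mono_on_biword[OF p' s'], of i]
      eq that by (simp add: biword_def)
  have less_iff: "p i < p k \<longleftrightarrow> p' i < p' k" if "i \<in> ?I" "k \<in> ?I" for i k
    using labelling_less_iff[OF p s that] labelling_less_iff[OF p' s' that] word that by simp
  have "p' (p i) = i" if "i \<in> ?I" for i
  proof (rule strict_mono_on_bij_id[of ?I "\<lambda>i. p' (p i)"])
    show "bij_betw (\<lambda>i. p' (p i)) ?I ?I"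
      using bij_betw_trans[OF signed_involution_bij[OF p] signed_involution_bij[OF p']] by (simp add: o_def)
    show "p' (p i) < p' (p k)" if "i \<in> ?I" "k \<in> ?I" "i < k" for i k
    proof -
      have "p i \<in> ?I" "p k \<in> ?I" using signed_involution_range[OF p] that by auto
      then show ?thesis using less_iff[of "p i" "p k"] that by (simp add: signed_involution_involutive[OF p])
    qed
  qed (use that in auto)
  then have "p i = p' i" if "i \<in> ?I" for i
    using that signed_involution_involutive[OF p'] by metis
  moreover have "p i = p' i" if "i \<notin> ?I" for i
    using signed_involution_out[OF p] signed_involution_out[OF p'] that by auto
  ultimately have "p = p'" by blast
  moreover have "s i = s' i" for i
  proof (cases "i \<in> ?I")
    case False
    then have "\<bar>i\<bar> > int n" by auto
    then show ?thesis using s s' by (simp add: labellings_def)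
  qed (use word in blast)
  ultimately show ?thesis by blast
qed

lemma sorted_enumeration:
  fixes M :: "'a :: linorder multiset"
  assumes "size M = 2 * n + 1"
  obtains X where "mono_on {- int n..int n} X" "image_mset X (mset_set {- int n..int n}) = M"
proof
  define xs where "xs = sorted_list_of_multiset M"
  have len: "length xs = 2 * n + 1" using assms by (metis xs_def mset_sorted_list_of_multiset size_mset)
  let ?X = "\<lambda>i. xs ! nat (i + int n)"
  show "mono_on {- int n..int n} ?X"
    by (intro monotone_onI sorted_nth_mono) (auto simp: xs_def len[unfolded xs_def])
  have "bij_betw (\<lambda>i. nat (i + int n)) {- int n..int n} {0..<2 * n + 1}"
    by (rule bij_betw_byWitness[of _ "\<lambda>j. int j - int n"]) auto
  from image_mset_mset_set_bij[OF this, of "(!) xs"]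
  have "image_mset ?X (mset_set {- int n..int n}) = mset (map ((!) xs) [0..<length xs])"
    by (simp add: len del: upt_Suc)
  then show "image_mset ?X (mset_set {- int n..int n}) = M"
    by (simp add: map_nth xs_def)
qed

text \<open>The inverse of \<^const>\<open>biword\<close>: the labels and their images are read off the sorted multiset, and
  the involution is the standardization of the word of second components.\<close>

lemma biword_surj:
  assumes M: "M \<in> sym_multisets n m"
  obtains p s where "p \<in> signed_involutions n" "s \<in> labellings n m p" "biword n p s = M"
proof -
  let ?I = "{- int n..int n}"
  have M_neg: "image_mset neg_pair M = M" and M_swap: "image_mset prod.swap M = M"
    and M_size: "size M = 2 * n + 1" and M_box: "set_mset M \<subseteq> {- m..m} \<times> {- m..m}"
    using M by (simp_all add: sym_multisets_def)
  obtain X where X_mono: "mono_on ?I X" and X_M: "image_mset X (mset_set ?I) = M"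
    using sorted_enumeration[OF M_size] .
  have X_neg: "X (- i) = neg_pair (X i)" if "i \<in> ?I" for i
  proof -
    have neg_le: "neg_pair y \<le> neg_pair x" if "x \<le> y" for x y
      using that by (cases x; cases y) auto
    \<comment> \<open>Negation reverses the order of the indices and of the pairs, so applying it to
      both gives another sorted listing of \<open>M\<close>.\<close>
    have "X (- i) = neg_pair (X (- (- i)))"
    proof (rule monotone_image_mset_unique[of ?I X "\<lambda>i. neg_pair (X (- i))"])
      show "mono_on ?I (\<lambda>i. neg_pair (X (- i)))"
        by (intro monotone_onI neg_le monotone_onD[OF X_mono]) auto
      have "image_mset (\<lambda>i. neg_pair (X (- i))) (mset_set ?I) = image_mset (\<lambda>i. neg_pair (X i)) (mset_set ?I)"
        by (rule image_mset_mset_set_bij[OF bij_betw_uminus])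
      also have "\<dots> = image_mset neg_pair (image_mset X (mset_set ?I))"
        by (simp add: multiset.map_comp o_def)
      finally show "image_mset X (mset_set ?I) = image_mset (\<lambda>i. neg_pair (X (- i))) (mset_set ?I)"
        using M_neg X_M by simp
    qed (use that X_mono in auto)
    then show ?thesis by simp
  qed
  define s where "s i = (if i \<in> ?I then fst (X i) else 0)" for i
  define w where "w i = snd (X i)" for i
  define key where "key i = (w i, i)" for i
  \<comment> \<open>Standardization: the rank of \<open>i\<close> by \<open>key\<close> lies between
    0 and \<open>2 * n\<close>, and subtracting \<open>n\<close> centres it.\<close>
  define p where "p i = (if i \<in> ?I then int (card {k\<in>?I. key k < key i}) - int n else i)" for i
  have X_eq: "X i = (s i, w i)" if "i \<in> ?I" for i using that by (simp add: s_def w_def)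
  have w_neg: "w (- i) = - w i" if "i \<in> ?I" for i
    using X_neg[OF that] by (simp add: w_def)
  have fin: "finite {j\<in>?I. P j}" for P
    by (rule finite_subset[of _ ?I]) auto
  have p_less: "p i < p k" if "i \<in> ?I" "k \<in> ?I" "key i < key k" for i k
  proof -
    have "{j\<in>?I. key j < key i} \<subset> {j\<in>?I. key j < key k}" using that by force
    then have "card {j\<in>?I. key j < key i} < card {j\<in>?I. key j < key k}"
      by (rule psubset_card_mono[OF fin])
    then show ?thesis using that by (simp add: p_def)
  qed
  have key_le: "key i \<le> key k" if "i \<in> ?I" "k \<in> ?I" "p i \<le> p k" for i k
    using p_less[OF that(2,1)] that(3) by force
  have key_inj: "key i = key k \<longleftrightarrow> i = k" for i k by (auto simp: key_def)
  have key_neg: "key (- k) < key (- i) \<longleftrightarrow> key i < key k" if "i \<in> ?I" "k \<in> ?I" for i k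
    using that by (auto simp: key_def w_neg)
  have p_range: "p i \<in> ?I" if "i \<in> ?I" for i
  proof -
    have "{k\<in>?I. key k < key i} \<subset> ?I" using that by (intro psubsetI) blast+
    then have "card {k\<in>?I. key k < key i} < card ?I"
      by (intro psubset_card_mono) simp_all
    then show ?thesis using that by (simp add: p_def)
  qed
  have p_inj: "inj_on p ?I"
  proof (rule inj_onI)
    fix i k assume ik: "i \<in> ?I" "k \<in> ?I" "p i = p k"
    from key_le[OF ik(1,2)] key_le[OF ik(2,1)] ik(3) have "key i = key k" by (intro order_antisym) simp_all
    then show "i = k" by (simp add: key_def)
  qed
  have "p ` ?I \<subseteq> ?I" using p_range by blast
  from endo_inj_surj[OF _ this p_inj] p_inj have p_bij: "bij_betw p ?I ?I"
    by (simp add: bij_betw_def)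
  have p_out: "p i = i" if "\<bar>i\<bar> > int n" for i using that by (auto simp: p_def)
  have p_neg: "p (- i) = - p i" for i
  proof (cases "i \<in> ?I")
    case i: True
    \<comment> \<open>Negation turns the positions ranked above \<open>i\<close> into those ranked
      below \<open>- i\<close>. As all \<open>2 * n + 1\<close> positions are below
      \<open>i\<close>, equal to \<open>i\<close> or above it, the centred ranks of \<open>i\<close>
      and \<open>- i\<close> are opposite.\<close>
    have "uminus ` {k\<in>?I. key i < key k} = {k\<in>?I. key k < key (- i)}"
    proof (intro equalityI subsetI)
      fix k assume "k \<in> {k\<in>?I. key k < key (- i)}"
      then have "key k < key (- i)" "- k \<in> ?I" by auto
      with key_neg[OF i, of "- k"] show "k \<in> uminus ` {k\<in>?I. key i < key k}"
        by (intro image_eqI[of _ _ "- k"]) simp_all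
    next
      fix k assume "k \<in> uminus ` {k\<in>?I. key i < key k}"
      then obtain k' where "k = - k'" "k' \<in> ?I" "key i < key k'" by blast
      with key_neg[OF i, of k'] show "k \<in> {k\<in>?I. key k < key (- i)}" by simp
    qed
    then have "bij_betw uminus {k\<in>?I. key i < key k} {k\<in>?I. key k < key (- i)}"
      by (simp add: bij_betw_def)
    then have "card {k\<in>?I. key k < key (- i)} = card {k\<in>?I. key i < key k}"
      by (simp add: bij_betw_same_card)
    moreover have "2 * n + 1 = Suc (card {k\<in>?I. key k < key i} + card {k\<in>?I. key i < key k})"
    proof -
      define lo hi where "lo = {k\<in>?I. key k < key i}" and "hi = {k\<in>?I. key i < key k}"
      have "finite lo" "finite hi" "i \<notin> lo \<union> hi" "lo \<inter> hi = {}"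
        unfolding lo_def hi_def using fin by force+
      moreover have "?I = insert i (lo \<union> hi)"
      proof (intro equalityI subsetI)
        fix k assume "k \<in> ?I"
        then show "k \<in> insert i (lo \<union> hi)" unfolding lo_def hi_def
          using key_inj[of k i] linorder_less_linear[of "key k" "key i"] by blast
      qed (use i in \<open>auto simp: lo_def hi_def\<close>)
      then have "card ?I = card (insert i (lo \<union> hi))" by (rule arg_cong)
      ultimately have "card ?I = Suc (card lo + card hi)"
        by (simp only: card_insert_disjoint finite_Un card_Un_disjoint simp_thms)
      then show ?thesis by (simp add: lo_def hi_def)
    qed
    ultimately show ?thesis using i by (simp add: p_def)
  next
    case False
    then show ?thesis by (auto simp: p_def)
  qed
  \<comment> \<open>The swapped pairs form the same multiset and are sorted along \<open>p\<close>:
    \<open>key\<close> compares second components first, and ties are broken by position, along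
    which \<open>X\<close> increases.\<close>
  have X_p: "prod.swap (X i) = X (p i)" if "i \<in> ?I" for i
  proof (rule monotone_along_bij_unique[OF _ p_bij X_mono _ _ that])
    fix i k assume ik: "i \<in> ?I" "k \<in> ?I" "p i \<le> p k"
    have "key i \<le> key k" by (rule key_le[OF ik])
    moreover have "X i \<le> X k" if "i \<le> k" using monotone_onD[OF X_mono ik(1,2) that] .
    ultimately show "prod.swap (X i) \<le> prod.swap (X k)"
      using ik by (auto simp: X_eq key_def)
  next
    show "image_mset X (mset_set ?I) = image_mset (\<lambda>i. prod.swap (X i)) (mset_set ?I)"
      using M_swap unfolding X_M[symmetric] by (simp add: multiset.map_comp o_def)
  qed simp
  have s_p: "s (p i) = w i" and w_p: "w (p i) = s i" if "i \<in> ?I" for i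
    using X_p[OF that] X_eq[OF that] X_eq[OF p_range[OF that]] by auto
  \<comment> \<open>On equal first components the sorted order makes \<open>w\<close> weakly
    increasing, and the position in \<open>key\<close> makes the comparison strict. So
    \<open>p\<close> has no descent between equal labels.\<close>
  have s_mono: "s i \<le> s k" and p_mono: "s i = s k \<Longrightarrow> p i < p k"
    if "i \<in> ?I" "k \<in> ?I" "i < k" for i k
  proof -
    have *: "X i \<le> X k" using monotone_onD[OF X_mono] that by simp
    then show "s i \<le> s k" using that by (auto simp: X_eq)
    assume "s i = s k"
    with * have "key i < key k" using that by (auto simp: X_eq key_def)
    then show "p i < p k" by (rule p_less[OF that(1,2)])
  qed
  have pp: "p (p i) = i" for i
  proof (cases "i \<in> ?I")
    case True
    show ?thesis
    proof (rule strict_mono_on_bij_id[of ?I "\<lambda>i. p (p i)"])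
      show "bij_betw (\<lambda>i. p (p i)) ?I ?I" using bij_betw_trans[OF p_bij p_bij] by (simp add: o_def)
      fix i k assume ik: "i \<in> ?I" "k \<in> ?I" "i < k"
      \<comment> \<open>By \<open>w_p\<close>, \<open>key (p i)\<close> is
        \<open>(s i, p i)\<close>, which increases strictly with \<open>i\<close>; so
        \<open>p (p i)\<close> does as well.\<close>
      have "key (p i) < key (p k)"
        using s_mono[OF ik] p_mono[OF ik] ik by (cases "s i = s k") (auto simp: key_def w_p)
      then show "p (p i) < p (p k)" using p_less p_range ik by blast
    qed (use True in auto)
  qed (auto simp: p_def)
  have p: "p \<in> signed_involutions n"
    by (rule signed_involutionI) (use p_neg p_out pp in auto)
  have "s (- i) = - s i" for i
    using X_neg by (auto simp: s_def)
  moreover have "s (int n) \<le> m"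
  proof -
    have "X (int n) \<in># M" unfolding X_M[symmetric] by simp
    then show ?thesis using M_box by (auto simp: s_def)
  qed
  moreover have "s i \<le> s (i + 1) \<and> (p i > p (i + 1) \<longrightarrow> s i < s (i + 1))" if "i \<in> {0..<int n}" for i
    using s_mono[of i "i + 1"] p_mono[of i "i + 1"] that by (cases "s i = s (i + 1)") auto
  ultimately have s: "s \<in> labellings n m p"
    by (auto simp: labellings_def s_def)
  have "biword n p s = image_mset X (mset_set ?I)"
    unfolding biword_def by (rule image_mset_cong) (simp add: s_p X_eq)
  with p s X_M show ?thesis using that by simp
qed

subsection \<open>Fixed points\<close>

text \<open>The linear order selects one element from each pair of moved points \<open>x\<close> and
  \<open>r x\<close>.\<close>

lemma card_involution:
  fixes r :: "'a :: linorder \<Rightarrow> 'a"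
  assumes fin: "finite A" and r: "\<And>x. x \<in> A \<Longrightarrow> r x \<in> A" "\<And>x. x \<in> A \<Longrightarrow> r (r x) = x"
  shows "card {x\<in>A. r x = x} + 2 * card {x\<in>A. x < r x} = card A"
proof -
  have "bij_betw r {x\<in>A. x < r x} {x\<in>A. r x < x}"
    by (rule bij_betw_byWitness[of _ r]) (use r in auto)
  then have "card {x\<in>A. r x < x} = card {x\<in>A. x < r x}" by (simp add: bij_betw_same_card)
  moreover have "card A = card {x\<in>A. r x = x} + card ({x\<in>A. x < r x} \<union> {x\<in>A. r x < x})"
    using fin by (subst card_Un_disjoint[symmetric]) (auto intro: arg_cong[of _ _ card] simp: not_less_iff_gr_or_eq)
  moreover have "card ({x\<in>A. x < r x} \<union> {x\<in>A. r x < x}) = card {x\<in>A. x < r x} + card {x\<in>A. r x < x}"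
    using fin by (intro card_Un_disjoint) auto
  ultimately show ?thesis by simp
qed

text \<open>Apply the preceding count to the involution that sends \<open>i\<close> to
  \<open>\<bar>p i\<bar>\<close>. Once \<open>n\<close> is given, the number of fixed points
  determines the number of two-cycles.\<close>

lemma cyc2_fixB:
  assumes p: "p \<in> signed_involutions n"
  shows "2 * cyc2 n p + fixB n p = n"
proof -
  have odd: "p (- i) = - p i" and inv: "p (p i) = i" for i
    using signed_involution_odd[OF p] signed_involution_involutive[OF p] by auto
  have zero: "p 0 = 0" using odd[of 0] by simp
  have ran: "\<bar>p i\<bar> \<in> {1..int n}" if "i \<in> {1..int n}" for i
  proof -
    have "p i \<noteq> 0" using inv[of i] zero that by auto
    then show ?thesis using signed_involution_range[OF p, of i] that by auto
  qed
  have abs_inv: "\<bar>p \<bar>p i\<bar>\<bar> = \<bar>i\<bar>" for i using odd inv by (simp add: abs_if)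
  have "{(i, k). i \<in> {1..int n} \<and> k \<in> {1..int n} \<and> i < k \<and> \<bar>p i\<bar> = k \<and> \<bar>p k\<bar> = i} =
    (\<lambda>i. (i, \<bar>p i\<bar>)) ` {i\<in>{1..int n}. i < \<bar>p i\<bar>}"
    using ran abs_inv by force
  then have "cyc2 n p = card {i\<in>{1..int n}. i < \<bar>p i\<bar>}"
    unfolding cyc2_def by (simp add: card_image inj_on_def)
  moreover have "fixB n p + 2 * card {i\<in>{1..int n}. i < \<bar>p i\<bar>} = card {1..int n}"
    unfolding fixB_def by (rule card_involution) (use ran abs_inv in auto)
  ultimately show ?thesis by simp
qed

lemma count_image_mset_set:
  assumes "finite A"
  shows "count (image_mset u (mset_set A)) x = card {i\<in>A. u i = x}"
  using card_filter_eq_size_image_mset[OF assms, of "\<lambda>y. y = x" u]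
  by (simp add: filter_eq_replicate_mset)

lemma finite_filter_box: "finite {i\<in>{- int n..int n}. P i}"
  by (rule finite_subset[of _ "{- int n..int n}"]) auto

lemma card_symmetric:
  assumes fin: "finite A" and A: "0 \<in> A" "\<And>i. i \<in> A \<Longrightarrow> - i \<in> A"
  shows "card A = 2 * card {i\<in>A. i > (0 :: int)} + 1"
proof -
  have "card {x\<in>A. - x = x} + 2 * card {x\<in>A. x < - x} = card A"
    by (rule card_involution[OF fin]) (simp_all add: A(2))
  moreover have "{x\<in>A. - x = x} = {0}" using A by auto
  moreover have "bij_betw uminus {x\<in>A. x < - x} {x\<in>A. 0 < x}"
    using A(2) by (intro bij_betw_byWitness[of _ uminus]) (simp_all add: image_subset_iff)
  then have "card {x\<in>A. x < - x} = card {x\<in>A. 0 < x}" by (rule bij_betw_same_card)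
  ultimately show ?thesis by simp
qed

definition is_diag :: "int \<times> int \<Rightarrow> bool" where
  "is_diag x \<longleftrightarrow> fst x = snd x"

text \<open>For a biword these are the labels of the positions \<open>i > 0\<close> with
  \<open>p i = - i\<close>, one label per position.\<close>

definition odd_antidiag :: "int \<Rightarrow> (int \<times> int) multiset \<Rightarrow> int set" where
  "odd_antidiag m M = {a\<in>{1..m}. odd (count M (a, - a))}"

text \<open>The positions carrying \<open>(0, 0)\<close> are closed under negation and include
  0.\<close>

lemma odd_count_biword_0:
  assumes p: "p \<in> signed_involutions n" and s: "s \<in> labellings n m p"
  shows "odd (count (biword n p s) (0, 0))"
proof -
  have odd: "s (- i) = - s i" for i using s by (simp add: labellings_def)
  have "p 0 = 0" "s 0 = 0" using odd[of 0] signed_involution_odd[OF p, of 0] by simp_all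
  then have "card {i\<in>{- int n..int n}. (s i, s (p i)) = (0, 0)} =
      2 * card {i\<in>{i\<in>{- int n..int n}. (s i, s (p i)) = (0, 0)}. i > 0} + 1"
    by (intro card_symmetric finite_filter_box) (auto simp: odd signed_involution_odd[OF p])
  then show ?thesis by (simp add: biword_def count_image_mset_set)
qed

text \<open>Equal labels at \<open>i\<close> and \<open>p i\<close> force \<open>p i = i\<close>: if
  \<open>i < p i\<close>, the lexicographic order at these two positions gives
  \<open>p i < p (p i) = i\<close>, and symmetrically. The summand 1 is the position 0.\<close>

lemma size_diag_biword:
  assumes p: "p \<in> signed_involutions n" and s: "s \<in> labellings n m p"
  shows "size (filter_mset is_diag (biword n p s)) = 2 * card {i\<in>{1..int n}. p i = i} + 1"
proof -
  let ?I = "{- int n..int n}"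
  have inv: "p (p i) = i" for i using signed_involution_involutive[OF p] .
  have "s i = s (p i) \<longleftrightarrow> p i = i" if i: "i \<in> ?I" for i
  proof
    assume eq: "s i = s (p i)"
    have pi: "p i \<in> ?I" by (rule signed_involution_range[OF p i])
    have "\<not> i < p i" using labelling_lex_less[OF p s, of i "p i"] i pi eq by (auto simp: inv)
    moreover have "\<not> p i < i" using labelling_lex_less[OF p s, of "p i" i] i pi eq by (auto simp: inv)
    ultimately show "p i = i" by simp
  qed simp
  then have "{i\<in>?I. is_diag (s i, s (p i))} = {i\<in>?I. p i = i}" by (auto simp: is_diag_def)
  moreover have "card {i\<in>?I. is_diag (s i, s (p i))} = size (filter_mset is_diag (biword n p s))"
    unfolding biword_def by (rule card_filter_eq_size_image_mset) simp
  moreover have "p 0 = 0" using signed_involution_odd[OF p, of 0] by simp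
  then have "card {i\<in>?I. p i = i} = 2 * card {i\<in>{i\<in>?I. p i = i}. i > 0} + 1"
    by (intro card_symmetric finite_filter_box) (auto simp: signed_involution_odd[OF p])
  moreover have "{i\<in>{i\<in>?I. p i = i}. i > 0} = {i\<in>{1..int n}. p i = i}" by auto
  ultimately show ?thesis by simp
qed

text \<open>On the positions carrying the pair \<open>(a, -a)\<close> the map \<open>i \<mapsto> - p i\<close> is a decreasing involution, so it
  has one fixed point if their number is odd, and none otherwise.\<close>

lemma card_odd_antidiag_biword:
  assumes p: "p \<in> signed_involutions n" and s: "s \<in> labellings n m p"
  shows "card (odd_antidiag m (biword n p s)) = card {i\<in>{1..int n}. p i = - i}"
proof -
  let ?I = "{- int n..int n}"
  have inv: "p (p i) = i" and p_odd: "p (- i) = - p i" for i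
    using signed_involution_involutive[OF p] signed_involution_odd[OF p] by auto
  have s_odd: "s (- i) = - s i" for i using s by (simp add: labellings_def)
  have zero: "p 0 = 0" "s 0 = 0" using s_odd[of 0] p_odd[of 0] by simp_all
  \<comment> \<open>Labels increase weakly and vanish at 0, so positive labels occur only at
    positive positions. This places the fixed points of the map \<open>- p i\<close> within
    \<open>{1..int n}\<close>.\<close>
  have pos: "i \<ge> 1" if "i \<in> ?I" "s i \<ge> 1" for i
  proof (rule ccontr)
    assume "\<not> i \<ge> 1"
    then have "i = 0 \<or> i < 0" by auto
    then show False using labelling_lex_less[OF p s, of i 0] that zero by auto
  qed
  have s_pos: "s i \<in> {1..m}" if "i \<in> {1..int n}" "p i = - i" for i
    using labelling_lex_less[OF p s, of 0 i] labelling_range[OF p s, of i] that zero by auto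
  \<comment> \<open>If \<open>i < k\<close> carry the same label, then \<open>p i < p k\<close>,
    that is \<open>- i < - k\<close>, a contradiction.\<close>
  have unique: "i = k" if "i \<in> {1..int n}" "p i = - i" "k \<in> {1..int n}" "p k = - k" "s i = s k" for i k
    using labelling_lex_less[OF p s, of i k] labelling_lex_less[OF p s, of k i] that
    by (cases i k rule: linorder_cases) auto
  define T where "T a = {i\<in>?I. (s i, s (p i)) = (a, - a)}" for a
  define Fx where "Fx a = {i\<in>{1..int n}. p i = - i \<and> s i = a}" for a
  have T_count: "count (biword n p s) (a, - a) = card (T a)" for a
    by (simp add: biword_def count_image_mset_set T_def)
  have parity: "odd (count (biword n p s) (a, - a)) \<longleftrightarrow> Fx a \<noteq> {}" if "a \<ge> 1" for a
  proof -
    have fin: "finite (T a)" unfolding T_def by (rule finite_filter_box)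
    have "card {i\<in>T a. - p i = i} + 2 * card {i\<in>T a. i < - p i} = card (T a)"
    proof (rule card_involution[OF fin])
      fix i assume "i \<in> T a"
      then show "- p i \<in> T a" using signed_involution_range[OF p, of i]
        by (auto simp: T_def s_odd p_odd inv)
    qed (simp add: p_odd inv)
    moreover have "{i\<in>T a. - p i = i} = Fx a"
    proof (intro equalityI subsetI)
      fix i assume "i \<in> {i\<in>T a. - p i = i}"
      then have "i \<in> ?I" "s i = a" "p i = - i" by (auto simp: T_def)
      with pos[of i] that show "i \<in> Fx a" by (simp add: Fx_def)
    next
      fix i assume "i \<in> Fx a"
      then show "i \<in> {i\<in>T a. - p i = i}" by (auto simp: Fx_def T_def s_odd)
    qed
    moreover have "finite (Fx a)" unfolding Fx_def by (rule finite_subset[of _ "{1..int n}"]) auto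
    moreover have "card (Fx a) \<le> 1"
      using card_le_Suc0_iff_eq[OF \<open>finite (Fx a)\<close>] unique by (simp add: Fx_def)
    ultimately have card_T: "card (Fx a) + 2 * card {i\<in>T a. i < - p i} = card (T a)"
      and fin: "finite (Fx a)" and le: "card (Fx a) \<le> 1" by simp_all
    have "odd (card (T a)) \<longleftrightarrow> odd (card (Fx a))" by (simp flip: card_T)
    also have "\<dots> \<longleftrightarrow> Fx a \<noteq> {}"
      using le card_gt_0_iff[of "Fx a"] fin by (cases "card (Fx a) = 0") (auto simp: le_Suc_eq)
    finally show ?thesis by (simp add: T_count)
  qed
  have img: "s ` {i\<in>{1..int n}. p i = - i} = odd_antidiag m (biword n p s)"
  proof (intro equalityI subsetI)
    fix a assume "a \<in> s ` {i\<in>{1..int n}. p i = - i}"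
    then obtain i where "i \<in> {1..int n}" "p i = - i" "a = s i" by blast
    then show "a \<in> odd_antidiag m (biword n p s)"
      using s_pos[of i] parity[of a] by (auto simp: odd_antidiag_def Fx_def)
  next
    fix a assume "a \<in> odd_antidiag m (biword n p s)"
    then have "Fx a \<noteq> {}" using parity[of a] by (simp add: odd_antidiag_def)
    then show "a \<in> s ` {i\<in>{1..int n}. p i = - i}" by (auto simp: Fx_def)
  qed
  have inj: "inj_on s {i\<in>{1..int n}. p i = - i}"
    using unique by (intro inj_onI) auto
  show ?thesis unfolding img[symmetric] by (rule card_image[OF inj])
qed

text \<open>The fixed points of \<open>\<bar>p i\<bar>\<close> split by the sign of
  \<open>p i\<close>, and both kinds can be read off the multiset. Doubling accounts for the
  positions \<open>i\<close> and \<open>- i\<close>.\<close>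

lemma fixB_biword:
  assumes p: "p \<in> signed_involutions n" and s: "s \<in> labellings n m p"
  shows "2 * fixB n p + 1 =
    size (filter_mset is_diag (biword n p s)) + 2 * card (odd_antidiag m (biword n p s))"
proof -
  have "{i\<in>{1..int n}. \<bar>p i\<bar> = i} = {i\<in>{1..int n}. p i = i} \<union> {i\<in>{1..int n}. p i = - i}"
    by auto
  moreover have "card ({i\<in>{1..int n}. p i = i} \<union> {i\<in>{1..int n}. p i = - i}) =
      card {i\<in>{1..int n}. p i = i} + card {i\<in>{1..int n}. p i = - i}"
    by (rule card_Un_disjoint) (auto intro: finite_subset[of _ "{1..int n}"])
  ultimately show ?thesis
    by (simp add: fixB_def size_diag_biword[OF p s] card_odd_antidiag_biword[OF p s])
qed

text \<open>The oddness at \<open>(0, 0)\<close> reserves one copy for the position 0 and leaves the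
  remaining copies in pairs, as the orbit decomposition requires.\<close>

definition sym_multisets_fix :: "nat \<Rightarrow> nat \<Rightarrow> int \<Rightarrow> (int \<times> int) multiset set" where
  "sym_multisets_fix n f m = {M \<in> sym_multisets n m. odd (count M (0, 0)) \<and>
     size (filter_mset is_diag M) + 2 * card (odd_antidiag m M) = 2 * f + 1}"

text \<open>Since \<open>fixB\<close> is a function of the multiset, the correspondence restricts to
  each value \<open>f\<close>.\<close>

lemma bij_betw_biword:
  "bij_betw (\<lambda>(p, s). biword n p s)
    (SIGMA p:{p \<in> signed_involutions n. fixB n p = f}. labellings n m p) (sym_multisets_fix n f m)"
proof (rule bij_betw_imageI)
  show "inj_on (\<lambda>(p, s). biword n p s) (SIGMA p:{p \<in> signed_involutions n. fixB n p = f}. labellings n m p)"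
    using biword_inj by (intro inj_onI) fast
  show "(\<lambda>(p, s). biword n p s) ` (SIGMA p:{p \<in> signed_involutions n. fixB n p = f}. labellings n m p) =
      sym_multisets_fix n f m"
  proof (intro equalityI subsetI)
    fix M assume "M \<in> (\<lambda>(p, s). biword n p s) `
      (SIGMA p:{p \<in> signed_involutions n. fixB n p = f}. labellings n m p)"
    then obtain p s where "p \<in> signed_involutions n" "s \<in> labellings n m p" "fixB n p = f" "M = biword n p s"
      by (elim imageE SigmaE) auto
    then show "M \<in> sym_multisets_fix n f m"
      using biword_in_sym_multisets odd_count_biword_0 fixB_biword[of p n s m]
      by (simp add: sym_multisets_fix_def)
  next
    fix M assume M: "M \<in> sym_multisets_fix n f m"
    then have "M \<in> sym_multisets n m" by (simp add: sym_multisets_fix_def)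
    then obtain p s where ps: "p \<in> signed_involutions n" "s \<in> labellings n m p" "biword n p s = M"
      by (rule biword_surj)
    then have "fixB n p = f" using fixB_biword[of p n s m] M by (simp add: sym_multisets_fix_def)
    with ps show "M \<in> (\<lambda>(p, s). biword n p s) `
      (SIGMA p:{p \<in> signed_involutions n. fixB n p = f}. labellings n m p)"
      by (intro image_eqI[of _ _ "(p, s)"]) auto
  qed
qed

subsection \<open>Orbit decomposition of symmetric multisets\<close>

text \<open>The pairs \<open>(a, b)\<close> with \<open>a \<noteq> b\<close> fall into \<open>m (m + 1)\<close> orbits under negation and swapping;
  \<open>orbit_reps m\<close> contains one pair from each. An orbit of a pair \<open>(a, -a)\<close> counts twice.\<close>

definition orbit_reps :: "int \<Rightarrow> (int \<times> int) set" where
  "orbit_reps m = (SIGMA a:{1..m}. {- a..<a})"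

definition orbit :: "int \<times> int \<Rightarrow> (int \<times> int) multiset" where
  "orbit = (\<lambda>(a, b). {#(a, b), (b, a), (- a, - b), (- b, - a)#})"

text \<open>The summands stand for the position 0, the two-cycles, the points
  \<open>p i = - i\<close> and the points \<open>p i = i\<close>, each together with its negatives.
  \<open>S\<close> is a set because the orbit of \<open>(a, - a)\<close> contains that pair twice,
  so only a parity is left over.\<close>

definition assemble ::
  "(int \<times> int) multiset \<Rightarrow> int set \<Rightarrow> int multiset \<Rightarrow> (int \<times> int) multiset" where
  "assemble G S H = {#(0, 0)#} + \<Sum>\<^sub># (image_mset orbit G)
     + \<Sum>\<^sub># (image_mset (\<lambda>a. {#(a, - a), (- a, a)#}) (mset_set S))
     + \<Sum>\<^sub># (image_mset (\<lambda>a. {#(a, a), (- a, - a)#}) H)"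

lemma finite_orbit_reps: "finite (orbit_reps m)"
  by (simp add: orbit_reps_def)

text \<open>The layer with first component \<open>m + 1\<close> adds \<open>2 * (m + 1)\<close>
  pairs.\<close>

lemma card_orbit_reps: "card (orbit_reps (int m)) = m ^ 2 + m"
proof (induction m)
  case (Suc m)
  have "orbit_reps (int (Suc m)) = orbit_reps (int m) \<union> {int m + 1} \<times> {- (int m + 1)..<int m + 1}"
    by (auto simp: orbit_reps_def)
  moreover have "card (orbit_reps (int m) \<union> {int m + 1} \<times> {- (int m + 1)..<int m + 1}) =
    card (orbit_reps (int m)) + card ({int m + 1} \<times> {- (int m + 1)..<int m + 1})"
    by (rule card_Un_disjoint) (auto simp: finite_orbit_reps, auto simp: orbit_reps_def)
  ultimately show ?case using Suc by (simp add: card_cartesian_product power2_eq_square)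
qed (simp add: orbit_reps_def)

lemma image_sum_orbits:
  assumes "\<And>x. image_mset h (o' x) = o' x"
  shows "image_mset h (\<Sum>\<^sub># (image_mset o' G)) = \<Sum>\<^sub># (image_mset o' G)"
  by (induction G) (simp_all add: assms)

lemma size_sum_orbits:
  fixes o' :: "'a \<Rightarrow> 'b multiset"
  assumes "\<And>x. x \<in># G \<Longrightarrow> size (o' x) = k"
  shows "size (\<Sum>\<^sub># (image_mset o' G)) = k * size G"
  using assms by (induction G) simp_all

text \<open>Here \<open>r\<close> is the only index whose orbit can contain \<open>y\<close>. With
  \<open>k = 0\<close> the lemma covers a \<open>y\<close> that lies in none of the orbits, and then
  \<open>r\<close> is arbitrary.\<close>

lemma count_sum_orbits:
  fixes o' :: "'a \<Rightarrow> 'b multiset"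
  assumes "\<And>x. x \<in># G \<Longrightarrow> count (o' x) y = (if x = r then k else 0)"
  shows "count (\<Sum>\<^sub># (image_mset o' G)) y = k * count G r"
  using assms by (induction G) simp_all

lemma filter_sum_orbits_empty:
  fixes o' :: "'a \<Rightarrow> 'b multiset"
  assumes "\<And>x. x \<in># G \<Longrightarrow> filter_mset P (o' x) = {#}"
  shows "filter_mset P (\<Sum>\<^sub># (image_mset o' G)) = {#}"
  using assms by (induction G) auto

lemma filter_sum_orbits_same:
  fixes o' :: "'a \<Rightarrow> 'b multiset"
  assumes "\<And>x. x \<in># G \<Longrightarrow> filter_mset P (o' x) = o' x"
  shows "filter_mset P (\<Sum>\<^sub># (image_mset o' G)) = \<Sum>\<^sub># (image_mset o' G)"
  using assms by (induction G) simp_all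

lemma neg_pair_assemble: "image_mset neg_pair (assemble G S H) = assemble G S H"
proof -
  have "image_mset neg_pair (orbit x) = orbit x" for x by (cases x) (simp add: orbit_def add_mset_commute)
  then show ?thesis by (simp add: assemble_def image_sum_orbits add_mset_commute)
qed

lemma swap_assemble: "image_mset prod.swap (assemble G S H) = assemble G S H"
proof -
  have "image_mset prod.swap (orbit x) = orbit x" for x by (cases x) (simp add: orbit_def add_mset_commute)
  then show ?thesis by (simp add: assemble_def image_sum_orbits add_mset_commute)
qed

lemma size_assemble:
  "finite S \<Longrightarrow> size (assemble G S H) = 1 + 4 * size G + 2 * card S + 2 * size H"
  using size_sum_orbits[of G orbit 4] size_sum_orbits[of H "\<lambda>a. {#(a, a), (- a, - a)#}" 2]
    size_sum_orbits[of "mset_set S" "\<lambda>a. {#(a, - a), (- a, a)#}" 2]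
  by (simp add: assemble_def orbit_def case_prod_unfold)

section \<open>Multiplicities in an assembled multiset\<close>

context
  fixes G :: "(int \<times> int) multiset" and S :: "int set" and H :: "int multiset" and m :: int
  assumes G: "set_mset G \<subseteq> orbit_reps m" and S: "S \<subseteq> {1..m}" and H: "set_mset H \<subseteq> {0..m}"
begin

private lemma finite_S: "finite S"
  using S by (rule finite_subset) simp

private lemma mem_G: "(a, b) \<in># G \<Longrightarrow> 1 \<le> a \<and> a \<le> m \<and> - a \<le> b \<and> b < a"
  using G by (auto simp: orbit_reps_def)

private lemma mem_S: "a \<in> S \<Longrightarrow> 1 \<le> a \<and> a \<le> m"
  using S by auto

private lemma mem_H: "a \<in># H \<Longrightarrow> 0 \<le> a \<and> a \<le> m"
  using H by auto

lemma range_assemble: "m \<ge> 0 \<Longrightarrow> set_mset (assemble G S H) \<subseteq> {- m..m} \<times> {- m..m}"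
proof
  fix x assume m: "m \<ge> 0" and "x \<in># assemble G S H"
  then consider "x = (0, 0)" | a b where "(a, b) \<in># G" "x \<in># orbit (a, b)"
    | a where "a \<in> S" "x \<in> {(a, - a), (- a, a)}" | a where "a \<in># H" "x \<in> {(a, a), (- a, - a)}"
    by (auto simp: assemble_def finite_S)
  then show "x \<in> {- m..m} \<times> {- m..m}"
  proof cases
    case 2
    then show ?thesis using mem_G[of a b] by (auto simp: orbit_def)
  next
    case 3
    then show ?thesis using mem_S[of a] by auto
  next
    case 4
    then show ?thesis using mem_H[of a] by auto
  qed (use m in simp)
qed

lemma count_assemble_0: "count (assemble G S H) (0, 0) = 1 + 2 * count H 0"
proof -
  have "count (\<Sum>\<^sub># (image_mset orbit G)) (0, 0) = 0 * count G (0, 0)"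
    by (rule count_sum_orbits) (auto simp: orbit_def dest!: mem_G)
  moreover have "count (\<Sum>\<^sub># (image_mset (\<lambda>a. {#(a, - a), (- a, a)#}) (mset_set S))) (0, 0) = 0 * count (mset_set S) 0"
    by (rule count_sum_orbits) (use finite_S in \<open>auto dest!: mem_S\<close>)
  moreover have "count (\<Sum>\<^sub># (image_mset (\<lambda>a. {#(a, a), (- a, - a)#}) H)) (0, 0) = 2 * count H 0"
    by (rule count_sum_orbits) auto
  ultimately show ?thesis by (simp add: assemble_def)
qed

lemma count_assemble_diag:
  assumes "a \<ge> 1" shows "count (assemble G S H) (a, a) = count H a"
proof -
  have "count (\<Sum>\<^sub># (image_mset orbit G)) (a, a) = 0 * count G (a, a)"
    by (rule count_sum_orbits) (auto simp: orbit_def dest!: mem_G)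
  moreover have "count (\<Sum>\<^sub># (image_mset (\<lambda>a. {#(a, - a), (- a, a)#}) (mset_set S))) (a, a) = 0 * count (mset_set S) a"
    by (rule count_sum_orbits) (use finite_S in \<open>auto dest!: mem_S\<close>)
  moreover have "count (\<Sum>\<^sub># (image_mset (\<lambda>a. {#(a, a), (- a, - a)#}) H)) (a, a) = 1 * count H a"
    by (rule count_sum_orbits) (use assms in \<open>auto dest!: mem_H\<close>)
  ultimately show ?thesis using assms by (simp add: assemble_def)
qed

text \<open>The representative \<open>(a, - a)\<close> equals its own negated swap, hence the factor
  2. The parity of the count reveals \<open>S\<close>.\<close>

lemma count_assemble_antidiag:
  assumes "a \<ge> 1"
  shows "count (assemble G S H) (a, - a) = 2 * count G (a, - a) + (if a \<in> S then 1 else 0)"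
proof -
  have "count (\<Sum>\<^sub># (image_mset orbit G)) (a, - a) = 2 * count G (a, - a)"
    by (rule count_sum_orbits) (use assms in \<open>auto simp: orbit_def split: if_splits dest!: mem_G\<close>)
  moreover have "count (\<Sum>\<^sub># (image_mset (\<lambda>a. {#(a, - a), (- a, a)#}) (mset_set S))) (a, - a) = 1 * count (mset_set S) a"
    by (rule count_sum_orbits) (use finite_S assms in \<open>auto dest!: mem_S\<close>)
  moreover have "count (\<Sum>\<^sub># (image_mset (\<lambda>a. {#(a, a), (- a, - a)#}) H)) (a, - a) = 0 * count H a"
    by (rule count_sum_orbits) (use assms in \<open>auto dest!: mem_H\<close>)
  ultimately show ?thesis using assms finite_S by (simp add: assemble_def)
qed

text \<open>Among the four pairs of an orbit, only the representative can have a first component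
  exceeding the absolute value of the second.\<close>

lemma count_assemble_generic:
  assumes "\<bar>b\<bar> < a"
  shows "count (assemble G S H) (a, b) = count G (a, b)"
proof -
  have "count (\<Sum>\<^sub># (image_mset orbit G)) (a, b) = 1 * count G (a, b)"
  proof (rule count_sum_orbits)
    fix x assume "x \<in># G"
    moreover obtain a' b' where "x = (a', b')" by fastforce
    ultimately show "count (orbit x) (a, b) = (if x = (a, b) then 1 else 0)"
      using mem_G[of a' b'] assms by (auto simp: orbit_def)
  qed
  moreover have "count (\<Sum>\<^sub># (image_mset (\<lambda>a. {#(a, - a), (- a, a)#}) (mset_set S))) (a, b) = 0 * count (mset_set S) a"
    by (rule count_sum_orbits) (use finite_S assms in \<open>auto dest!: mem_S\<close>)
  moreover have "count (\<Sum>\<^sub># (image_mset (\<lambda>a. {#(a, a), (- a, - a)#}) H)) (a, b) = 0 * count H a"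
    by (rule count_sum_orbits) (use assms in \<open>auto dest!: mem_H\<close>)
  moreover have "a \<noteq> 0" using assms by auto
  ultimately show ?thesis by (simp add: assemble_def)
qed

lemma size_diag_assemble: "size (filter_mset is_diag (assemble G S H)) = 1 + 2 * size H"
proof -
  have "filter_mset is_diag (\<Sum>\<^sub># (image_mset orbit G)) = {#}"
    by (rule filter_sum_orbits_empty) (auto simp: orbit_def is_diag_def dest!: mem_G)
  moreover have "filter_mset is_diag (\<Sum>\<^sub># (image_mset (\<lambda>a. {#(a, - a), (- a, a)#}) (mset_set S))) = {#}"
    by (rule filter_sum_orbits_empty) (use finite_S in \<open>auto simp: is_diag_def dest!: mem_S\<close>)
  moreover have "filter_mset is_diag (\<Sum>\<^sub># (image_mset (\<lambda>a. {#(a, a), (- a, - a)#}) H)) =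
      \<Sum>\<^sub># (image_mset (\<lambda>a. {#(a, a), (- a, - a)#}) H)"
    by (rule filter_sum_orbits_same) (auto simp: is_diag_def)
  moreover have "size (\<Sum>\<^sub># (image_mset (\<lambda>a. {#(a, a), (- a, - a)#}) H)) = 2 * size H"
    by (rule size_sum_orbits) simp
  moreover have "is_diag (0, 0)" by (simp add: is_diag_def)
  ultimately show ?thesis by (simp add: assemble_def)
qed

lemma odd_antidiag_assemble: "odd_antidiag m (assemble G S H) = S"
  using S count_assemble_antidiag by (auto simp: odd_antidiag_def split: if_splits)

end

section \<open>Unique decomposition into orbits\<close>

lemma count_image_mset_inj: "inj h \<Longrightarrow> count (image_mset h M) (h x) = count M x"
  by (induction M) (auto simp: inj_eq)

text \<open>Every orbit under negation and swapping meets the cone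
  \<open>\<bar>b\<bar> \<le> a\<close>.\<close>

lemma sym_multiset_eqI:
  assumes M: "image_mset neg_pair M = M" "image_mset prod.swap M = M"
    and M': "image_mset neg_pair M' = M'" "image_mset prod.swap M' = M'"
    and eq: "\<And>a b. \<bar>b\<bar> \<le> a \<Longrightarrow> count M (a, b) = count M' (a, b)"
  shows "M = M'"
proof (rule multiset_eqI)
  have sym: "count M (- a, - b) = count M (a, b)" "count M (b, a) = count M (a, b)"
    if "image_mset neg_pair M = M" "image_mset prod.swap M = M" for M :: "(int \<times> int) multiset" and a b
  proof -
    have "inj neg_pair" by (auto simp: inj_def)
    from count_image_mset_inj[OF this, of M "(a, b)"] that(1)
    show "count M (- a, - b) = count M (a, b)" by simp
    from count_image_mset_inj[OF inj_swap, of M "(a, b)"] that(2)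
    show "count M (b, a) = count M (a, b)" by simp
  qed
  have *: "count M (a, b) = count M' (a, b)" if "\<bar>b\<bar> \<le> \<bar>a\<bar>" for a b
    using eq[of b a] eq[of "- b" "- a"] that sym(1)[OF M] sym(1)[OF M'] by (cases "a \<ge> 0") auto
  fix x show "count M x = count M' x"
  proof (cases x)
    case (Pair a b)
    then show ?thesis
      using *[of a b] *[of b a] sym(2)[OF M, of a b] sym(2)[OF M', of a b] by (cases "\<bar>b\<bar> \<le> \<bar>a\<bar>") auto
  qed
qed

lemma ex_multiset_count:
  assumes "finite A" obtains G where "set_mset G \<subseteq> A" "\<And>x. x \<in> A \<Longrightarrow> count G x = g x"
proof
  let ?G = "\<Sum>x\<in>A. replicate_mset (g x) x"
  show count: "count ?G x = g x" if "x \<in> A" for x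
    using assms that by (simp add: count_sum)
  show "set_mset ?G \<subseteq> A"
    using assms by (auto simp: set_mset_sum split: if_splits)
qed

text \<open>The multiplicities recover \<open>G\<close>, \<open>S\<close> and \<open>H\<close>, and
  conversely they can be prescribed freely. The bound \<open>card S \<le> f\<close> keeps the
  subtraction in the size of \<open>H\<close> exact.\<close>

lemma bij_betw_assemble:
  assumes "m \<ge> 0"
  shows "bij_betw (\<lambda>(G, S, H). assemble G S H)
    (multisets_of_size (orbit_reps m) j \<times>
      (SIGMA S:{S. S \<subseteq> {1..m} \<and> card S \<le> f}. multisets_of_size {0..m} (f - card S)))
    (sym_multisets_fix (2 * j + f) f m)" (is "bij_betw ?a ?D _")
proof (rule bij_betw_imageI)
  show "inj_on ?a ?D"
  proof (rule inj_onI)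
    fix x y assume "x \<in> ?D" "y \<in> ?D" "?a x = ?a y"
    moreover obtain G S H G' S' H' where xy: "x = (G, S, H)" "y = (G', S', H')"
      by (metis prod.collapse)
    ultimately have "G \<in> multisets_of_size (orbit_reps m) j" "S \<subseteq> {1..m}" "H \<in> multisets_of_size {0..m} (f - card S)"
      "G' \<in> multisets_of_size (orbit_reps m) j" "S' \<subseteq> {1..m}" "H' \<in> multisets_of_size {0..m} (f - card S')"
      and eq: "assemble G S H = assemble G' S' H'" by simp_all
    then have GSH: "set_mset G \<subseteq> orbit_reps m" "S \<subseteq> {1..m}" "set_mset H \<subseteq> {0..m}"
      and GSH': "set_mset G' \<subseteq> orbit_reps m" "S' \<subseteq> {1..m}" "set_mset H' \<subseteq> {0..m}"
      by (simp_all add: multisets_of_size_def)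
    have S: "S = S'" using odd_antidiag_assemble[OF GSH] odd_antidiag_assemble[OF GSH'] eq by simp
    moreover have "G = G'"
    proof (rule multiset_eqI)
      fix x show "count G x = count G' x"
      proof (cases "x \<in> orbit_reps m")
        case True
        then obtain a b where x: "x = (a, b)" "a \<ge> 1" "- a \<le> b" "b < a" by (auto simp: orbit_reps_def)
        show ?thesis
        proof (cases "b = - a")
          case True
          then show ?thesis using x S eq count_assemble_antidiag[OF GSH x(2)] count_assemble_antidiag[OF GSH' x(2)]
            by simp
        next
          case False
          with x have "\<bar>b\<bar> < a" by auto
          from count_assemble_generic[OF GSH this] count_assemble_generic[OF GSH' this]
          show ?thesis using x eq by simp
        qed
      next
        case False
        then show ?thesis using GSH(1) GSH'(1) by (metis count_eq_zero_iff subsetD)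
      qed
    qed
    moreover have "H = H'"
    proof (rule multiset_eqI)
      fix a :: int
      consider "a < 0" | "a = 0" | "a \<ge> 1" by linarith
      then show "count H a = count H' a"
      proof cases
        case 1
        then have "a \<notin># H" "a \<notin># H'" using GSH(3) GSH'(3) by fastforce+
        then show ?thesis by (metis not_in_iff)
      next
        case 2
        then show ?thesis using count_assemble_0[OF GSH] count_assemble_0[OF GSH'] eq by simp
      next
        case 3
        then show ?thesis using count_assemble_diag[OF GSH 3] count_assemble_diag[OF GSH' 3] eq by simp
      qed
    qed
    ultimately show "x = y" by (simp add: xy)
  qed
next
  show "?a ` ?D = sym_multisets_fix (2 * j + f) f m"
  proof (intro equalityI subsetI)
    fix M assume "M \<in> ?a ` ?D"
    then obtain G S H where M: "M = assemble G S H" and G: "G \<in> multisets_of_size (orbit_reps m) j"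
      and S: "S \<subseteq> {1..m}" "card S \<le> f" and H: "H \<in> multisets_of_size {0..m} (f - card S)"
      by (elim imageE SigmaE) auto
    have GSH: "set_mset G \<subseteq> orbit_reps m" "S \<subseteq> {1..m}" "set_mset H \<subseteq> {0..m}"
      and sizes: "size G = j" "size H = f - card S"
      using G S H by (simp_all add: multisets_of_size_def)
    have "finite S" using S finite_subset by blast
    moreover have "2 * card S + 2 * (f - card S) = 2 * f" "2 * (f - card S) + 2 * card S = 2 * f"
      using S(2) by linarith+
    ultimately show "M \<in> sym_multisets_fix (2 * j + f) f m"
      using GSH sizes assms by (simp add: M sym_multisets_fix_def sym_multisets_def neg_pair_assemble swap_assemble size_assemble
          range_assemble count_assemble_0 size_diag_assemble odd_antidiag_assemble)
  next
    fix M assume "M \<in> sym_multisets_fix (2 * j + f) f m"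
    then have M: "image_mset neg_pair M = M" "image_mset prod.swap M = M"
      and M_size: "size M = 2 * (2 * j + f) + 1" and M_box: "set_mset M \<subseteq> {- m..m} \<times> {- m..m}"
      and M_odd: "odd (count M (0, 0))"
      and M_fix: "size (filter_mset is_diag M) + 2 * card (odd_antidiag m M) = 2 * f + 1"
      by (simp_all add: sym_multisets_fix_def sym_multisets_def)
    define S where "S = odd_antidiag m M"
    \<comment> \<open>Antidiagonal counts are halved because the orbit of \<open>(a, - a)\<close>
      contains it twice; the remainder goes to \<open>S\<close>.\<close>
    obtain G where G: "set_mset G \<subseteq> orbit_reps m" and G_count: "\<And>x. x \<in> orbit_reps m \<Longrightarrow>
        count G x = (if snd x = - fst x then count M x div 2 else count M x)"
      using ex_multiset_count[OF finite_orbit_reps,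
          of m "\<lambda>x. if snd x = - fst x then count M x div 2 else count M x"] by blast
    \<comment> \<open>A label 0 in \<open>H\<close> contributes \<open>(0, 0)\<close> twice, and the
      odd remaining copy is the fixed summand of \<open>assemble\<close>.\<close>
    obtain H where H: "set_mset H \<subseteq> {0..m}" and H_count: "\<And>a. a \<in> {0..m} \<Longrightarrow>
        count H a = (if a = 0 then count M (0, 0) div 2 else count M (a, a))"
      using ex_multiset_count[of "{0..m}" "\<lambda>a. if a = 0 then count M (0, 0) div 2 else count M (a, a)"] by blast
    have S: "S \<subseteq> {1..m}" by (auto simp: S_def odd_antidiag_def)
    then have fin_S: "finite S" by (rule finite_subset) simp
    have M_eq: "assemble G S H = M"
    proof (rule sym_multiset_eqI[OF neg_pair_assemble swap_assemble M])
      fix a b :: int assume ab: "\<bar>b\<bar> \<le> a"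
      show "count (assemble G S H) (a, b) = count M (a, b)"
      proof (cases "a \<le> m")
        case True
        consider "a = 0" "b = 0" | "a \<ge> 1" "b = a" | "a \<ge> 1" "b = - a" | "a \<ge> 1" "\<bar>b\<bar> < a" using ab by linarith
        then show ?thesis
        proof cases
          case 1
          then show ?thesis using True M_odd H_count[of 0] by (simp add: count_assemble_0[OF G S H])
        next
          case 2
          then show ?thesis using True H_count[of a] by (simp add: count_assemble_diag[OF G S H])
        next
          case 3
          then have "(a, b) \<in> orbit_reps m" "a \<in> S \<longleftrightarrow> odd (count M (a, - a))" using True
            by (auto simp: orbit_reps_def S_def odd_antidiag_def)
          with 3 show ?thesis using G_count[of "(a, b)"]
            by (simp add: count_assemble_antidiag[OF G S H])
        next
          case 4
          then have "(a, b) \<in> orbit_reps m" "b \<noteq> - a" using True by (auto simp: orbit_reps_def)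
          then show ?thesis using 4 G_count[of "(a, b)"] by (simp add: count_assemble_generic[OF G S H])
        qed
      next
        case False
        \<comment> \<open>Beyond the box both multiplicities are 0.\<close>
        then have "(a, b) \<notin># M" "(a, b) \<notin># assemble G S H"
          using M_box range_assemble[OF G S H assms] by auto
        then show ?thesis by (metis not_in_iff)
      qed
    qed
    \<comment> \<open>The diagonal part has size \<open>1 + 2 * size H\<close>, so
      \<open>M_fix\<close> gives \<open>size H + card S = f\<close>. The total size then leaves
      \<open>4 * j\<close> for the orbits, each of size 4.\<close>
    have "size H + card S = f"
      using M_fix size_diag_assemble[OF G S H] unfolding M_eq by (simp flip: S_def)
    moreover from this have "size G = j"
      using M_size size_assemble[OF fin_S, of G H] by (simp add: M_eq)
    ultimately have "(G, S, H) \<in> ?D" using G S H by (auto simp: multisets_of_size_def)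
    then show "M \<in> ?a ` ?D" using M_eq by (intro image_eqI[of _ _ "(G, S, H)"]) simp_all
  qed
qed

section \<open>Counting the decompositions\<close>

text \<open>Cauchy product of the two factors. The summand chooses \<open>k\<close> of
  \<open>m\<close> labels for points \<open>p i = - i\<close> and a multiset of \<open>f - k\<close>
  of \<open>m + 1\<close> labels for points \<open>p i = i\<close>.\<close>

lemma c_eq_sum:
  "c f m = (\<Sum>k\<le>f. of_nat ((m choose k) * ((m + 1 + (f - k) - 1) choose (f - k))))"
proof -
  have "(1 + fps_X :: rat fps) ^ m / (1 - fps_X) ^ (m + 1) =
      (1 + fps_X) ^ m * inverse ((1 - fps_const 1 * fps_X) ^ (m + 1))"
    by (simp add: fps_divide_unit)
  then have "c f m = (\<Sum>k=0..f. fps_nth ((1 + fps_X) ^ m) k * fps_nth (inverse ((1 - fps_const 1 * fps_X) ^ (m + 1))) (f - k))"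
    unfolding c_def by (simp only: fps_mult_nth)
  also have "\<dots> = (\<Sum>k\<le>f. of_nat ((m choose k) * ((m + 1 + (f - k) - 1) choose (f - k))))"
  proof (rule sum.cong)
    fix k
    have "fps_nth ((1 + fps_X :: rat fps) ^ m) k = of_nat (m choose k)"
      by (simp flip: fps_binomial_of_nat add: binomial_gbinomial)
    moreover have "fps_nth (inverse ((1 - fps_const 1 * fps_X :: rat fps) ^ (m + 1))) (f - k) =
        of_nat ((m + 1 + (f - k) - 1) choose (f - k))"
      by (subst one_minus_const_fps_X_neg_power') simp_all
    ultimately show "fps_nth ((1 + fps_X :: rat fps) ^ m) k *
        fps_nth (inverse ((1 - fps_const 1 * fps_X :: rat fps) ^ (m + 1))) (f - k) =
        of_nat ((m choose k) * ((m + 1 + (f - k) - 1) choose (f - k)))"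
      by (simp only: of_nat_mult)
  qed auto
  finally show ?thesis .
qed

lemma gchoose_eq_card:
  "((of_nat (m ^ 2 + m + j) - 1 :: rat) gchoose j) = of_nat (card (multisets_of_size (orbit_reps (int m)) j))"
\<comment> \<open>For \<open>m = j = 0\<close> the upper argument is -1, which no natural number
  represents; there both sides are 1.\<close>
proof (cases "m ^ 2 + m + j = 0")
  case False
  then have "(of_nat (m ^ 2 + m + j) - 1 :: rat) = of_nat (m ^ 2 + m + j - 1)"
    by (simp only: of_nat_diff)
  then show ?thesis
    by (simp only: card_multisets_of_size[OF finite_orbit_reps] card_orbit_reps binomial_gbinomial)
qed (auto simp: card_multisets_of_size)

lemma card_sym_multisets_fix:
  "of_nat (card (sym_multisets_fix (2 * j + f) f (int m))) =
    c f m * ((of_nat (m ^ 2 + m + j) - 1) gchoose j)"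
proof -
  let ?U = "{S. S \<subseteq> {1..int m} \<and> card S \<le> f}"
  let ?h = "\<lambda>k. (m + 1 + (f - k) - 1) choose (f - k)"
  have fin: "finite ?U" by (rule finite_subset[of _ "Pow {1..int m}"]) auto
  have "card (SIGMA S:?U. multisets_of_size {0..int m} (f - card S)) = (\<Sum>S\<in>?U. ?h (card S))"
    using fin by (subst card_SigmaI) (auto simp: card_multisets_of_size nat_add_distrib)
  \<comment> \<open>Grouping the sets \<open>S\<close> by cardinality yields the coefficient sum for
    \<open>c f m\<close>.\<close>
  also have "\<dots> = (\<Sum>k\<le>f. \<Sum>S\<in>{S\<in>?U. card S = k}. ?h (card S))"
    using fin by (intro sum.group[symmetric]) auto
  also have "\<dots> = (\<Sum>k\<le>f. (m choose k) * ?h k)"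
  proof (rule sum.cong[OF refl])
    fix k assume "k \<in> {..f}"
    then have "{S\<in>?U. card S = k} = {S. S \<subseteq> {1..int m} \<and> card S = k}" by auto
    then have "card {S\<in>?U. card S = k} = (m choose k)" by (simp add: n_subsets)
    moreover have "(\<Sum>S\<in>{S\<in>?U. card S = k}. ?h (card S)) = (\<Sum>S\<in>{S\<in>?U. card S = k}. ?h k)"
      by (rule sum.cong) simp_all
    ultimately show "(\<Sum>S\<in>{S\<in>?U. card S = k}. ?h (card S)) = (m choose k) * ?h k"
      by (simp only: sum_constant of_nat_id)
  qed
  finally have "of_nat (card (SIGMA S:?U. multisets_of_size {0..int m} (f - card S))) = c f m"
    by (simp only: c_eq_sum of_nat_sum)
  moreover have "card (sym_multisets_fix (2 * j + f) f (int m)) =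
      card (multisets_of_size (orbit_reps (int m)) j) *
      card (SIGMA S:?U. multisets_of_size {0..int m} (f - card S))"
    using bij_betw_same_card[OF bij_betw_assemble[of "int m" j f]] by (simp add: card_cartesian_product)
  ultimately show ?thesis
    by (simp only: gchoose_eq_card of_nat_mult mult.commute)
qed

section \<open>The generating function identity\<close>

theorem proposition4p1:
  fixes j f :: nat
  shows "fps_of_poly (F j f) / (1 - fps_X) ^ (2 * j + f + 1) =
    Abs_fps (\<lambda>m. c f m * ((of_nat (m ^ 2 + m + j) - 1) gchoose j))"
proof (rule fps_ext)
  fix m
  let ?n = "2 * j + f"
  let ?P = "{p \<in> signed_involutions ?n. fixB ?n p = f}"
  \<comment> \<open>As \<open>2 * cyc2 ?n p + fixB ?n p = ?n\<close>, having \<open>f\<close> fixed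
    points forces \<open>j\<close> two-cycles.\<close>
  have P: "{p \<in> signed_involutions ?n. cyc2 ?n p = j \<and> fixB ?n p = f} = ?P"
    using cyc2_fixB[of _ ?n] by fastforce
  have fin: "finite ?P"
    by (rule finite_subset[OF _ finite_signed_perms[of ?n]]) (auto simp: signed_involutions_def)
  have "fps_of_poly (F j f) / (1 - fps_X) ^ (?n + 1) =
      (\<Sum>p\<in>?P. fps_X ^ desB ?n p / (1 - fps_X) ^ (?n + 1))"
    unfolding F_def P
    by (simp add: fps_of_poly_sum fps_of_poly_monom' fps_divide_unit sum_distrib_right)
  \<comment> \<open>Each involution contributes the generating function of its labellings, so the
    coefficient counts pairs of an involution and a labelling bounded by \<open>m\<close>.\<close>
  then have "fps_nth (fps_of_poly (F j f) / (1 - fps_X) ^ (?n + 1)) m =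
      (\<Sum>p\<in>?P. of_nat (card (labellings ?n (int m) p)))"
    by (simp only: fps_card_labellings[symmetric] fps_sum_nth fps_nth_Abs_fps)
  also have "\<dots> = of_nat (card (SIGMA p:?P. labellings ?n (int m) p))"
    using fin by (subst card_SigmaI) (auto simp: finite_labellings)
  also have "\<dots> = of_nat (card (sym_multisets_fix ?n f (int m)))"
    by (simp only: bij_betw_same_card[OF bij_betw_biword])
  also have "\<dots> = c f m * ((of_nat (m ^ 2 + m + j) - 1) gchoose j)"
    by (rule card_sym_multisets_fix)
  finally show "fps_nth (fps_of_poly (F j f) / (1 - fps_X) ^ (?n + 1)) m =
      fps_nth (Abs_fps (\<lambda>m. c f m * ((of_nat (m ^ 2 + m + j) - 1) gchoose j))) m"
    by simp
qed

end
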